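(* For any $c\in\mathcal C$, the stochastic differential equation $$dX_t=(X_t^\alpha-\mu X_t-c_tX_t)\,dt-\sigma X_t\,dW_t\quad (t>0),\qquad X_0=0,$$ has the two distinct strong solutions $X\equiv0$ and $$\widetilde X_t:=\begin{cases}0,& t=0,\\ \Big(\dfrac{1-\alpha}{G_t}\displaystyle\int_0^tG_s\,ds\Big)^{\frac1{1-\alpha}}>0,& t>0,\end{cases}$$ where $$G_t:=\exp\Big(\int_0^t\big(-b_s+\tfrac{\sigma^2a^2}{2}\big)ds+\sigma aW_t\Big),\qquad a:=1-\alpha,\quad b_t:=-(1-\alpha)\big(\mu+c_t+\tfrac12\sigma^2\alpha\big).$$
   Context: Let $\Omega=\{\omega\in C([0,\infty);\mathbb R):\omega_0=0\}$, $W$ the canonical process, $\mathbb P$ the Wiener measure, and $\mathbb F=\{\mathcal F_t\}_{t\ge0}$ the $\mathbb P$-augmentation of the natural filtration of $W$. Constants: $\alpha\in(0,1)$, $\sigma>0$, $\mu>0$. $\mathcal C$ is the set of progressively measurable $c:\Omega\times[0,\infty)\to[0,\infty)$ with $\int_0^t c_s\,ds<\infty$ for all $t>0$ a.s. A strong solution is a continuous $\mathbb F$-adapted $[0,\infty)$-valued process satisfying the integrated equation for all $t\ge 0$ a.s. *)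

theory Defs
  imports "HOL-Probability.Probability"
begin

section \<open>Path space, Wiener measure, filtrations\<close>

text \<open>
  Processes are written \<open>X t \<omega>\<close>, with \<open>t :: real\<close>; only times \<open>t \<ge> 0\<close> are ever relevant.
  A path is an extensional function on \<open>{0..}\<close>, so that it is determined by its values there.
\<close>

definition path_space :: "(real \<Rightarrow> real) set" where
  "path_space = {\<omega> \<in> extensional {0..}. continuous_on {0..} \<omega> \<and> \<omega> 0 = 0}"

definition path_algebra :: "(real \<Rightarrow> real) measure" where
  "path_algebra = restrict_space (PiM {0..} (\<lambda>_. borel)) path_space"

definition W :: "real \<Rightarrow> (real \<Rightarrow> real) \<Rightarrow> real" where
  "W t \<omega> = \<omega> t"

definition natural_filtration :: "'a measure \<Rightarrow> (real \<Rightarrow> 'a \<Rightarrow> real) \<Rightarrow> real \<Rightarrow> 'a measure" where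
  "natural_filtration M X t =
     sigma (space M) {X s -` B \<inter> space M | s B. 0 \<le> s \<and> s \<le> t \<and> B \<in> sets borel}"

definition augmented_filtration :: "'a measure \<Rightarrow> (real \<Rightarrow> 'a \<Rightarrow> real) \<Rightarrow> real \<Rightarrow> 'a measure" where
  "augmented_filtration M X t =
     sigma (space M) (sets (natural_filtration M X t) \<union> null_sets (completion M))"

text \<open>
  The Wiener measure is the unique law on path space making the canonical process a standard
  Brownian motion; it is characterised here by a predicate.
\<close>

definition wiener_measure :: "(real \<Rightarrow> real) measure \<Rightarrow> bool" where
  "wiener_measure P \<longleftrightarrow>
     prob_space P \<and> space P = path_space \<and> sets P = sets path_algebra \<and>
     (\<forall>s t. 0 \<le> s \<and> s < t \<longrightarrow>
        distributed P lborel (\<lambda>\<omega>. W t \<omega> - W s \<omega>) (normal_density 0 (sqrt (t - s))) \<and>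
        prob_space.indep_set P
          (sets (natural_filtration P W s))
          {(\<lambda>\<omega>. W t \<omega> - W s \<omega>) -` B \<inter> space P | B. B \<in> sets borel})"

definition adapted :: "(real \<Rightarrow> 'a measure) \<Rightarrow> (real \<Rightarrow> 'a \<Rightarrow> real) \<Rightarrow> bool" where
  "adapted F X \<longleftrightarrow> (\<forall>t\<ge>0. X t \<in> borel_measurable (F t))"

definition progressively_measurable ::
    "(real \<Rightarrow> 'a measure) \<Rightarrow> (real \<Rightarrow> 'a \<Rightarrow> real) \<Rightarrow> bool" where
  "progressively_measurable F X \<longleftrightarrow>
     (\<forall>t\<ge>0. (\<lambda>(s, \<omega>). X s \<omega>) \<in> borel_measurable (restrict_space borel {0..t} \<Otimes>\<^sub>M F t))"

text \<open>
  Path properties are required almost surely, processes being identified up to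
  indistinguishability.
\<close>

definition continuous_process :: "'a measure \<Rightarrow> (real \<Rightarrow> 'a \<Rightarrow> real) \<Rightarrow> bool" where
  "continuous_process M X \<longleftrightarrow> (AE \<omega> in M. continuous_on {0..} (\<lambda>t. X t \<omega>))"

definition indistinguishable ::
    "'a measure \<Rightarrow> (real \<Rightarrow> 'a \<Rightarrow> real) \<Rightarrow> (real \<Rightarrow> 'a \<Rightarrow> real) \<Rightarrow> bool" where
  "indistinguishable M X Y \<longleftrightarrow> (AE \<omega> in M. \<forall>t\<ge>0. X t \<omega> = Y t \<omega>)"

section \<open>The It\^o integral\<close>

text \<open>
  The data \<open>(k, t, \<xi>)\<close> encode the simple integrand
  \<open>\<Sum>i<k. \<xi>\<^sub>i 1\<^bsub>(t\<^sub>i, t\<^sub>i\<^sub>+\<^sub>1]\<^esub>\<close> with bounded \<open>F (t\<^sub>i)\<close>-measurable heights \<open>\<xi>\<^sub>i\<close>.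
\<close>

definition simple_integrand ::
    "(real \<Rightarrow> 'a measure) \<Rightarrow> nat \<Rightarrow> (nat \<Rightarrow> real) \<Rightarrow> (nat \<Rightarrow> 'a \<Rightarrow> real) \<Rightarrow> bool" where
  "simple_integrand F k t \<xi> \<longleftrightarrow>
     0 \<le> t 0 \<and>
     (\<forall>i<k. t i < t (Suc i) \<and> \<xi> i \<in> borel_measurable (F (t i)) \<and>
        (\<exists>B. \<forall>\<omega>\<in>space (F (t i)). \<bar>\<xi> i \<omega>\<bar> \<le> B))"

definition simple_process ::
    "nat \<Rightarrow> (nat \<Rightarrow> real) \<Rightarrow> (nat \<Rightarrow> 'a \<Rightarrow> real) \<Rightarrow> real \<Rightarrow> 'a \<Rightarrow> real" where
  "simple_process k t \<xi> s \<omega> = (\<Sum>i<k. \<xi> i \<omega> * indicator {t i <.. t (Suc i)} s)"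

definition simple_integral ::
    "(real \<Rightarrow> 'a \<Rightarrow> real) \<Rightarrow> nat \<Rightarrow> (nat \<Rightarrow> real) \<Rightarrow> (nat \<Rightarrow> 'a \<Rightarrow> real) \<Rightarrow> real \<Rightarrow> 'a \<Rightarrow> real" where
  "simple_integral B k t \<xi> s \<omega> =
     (\<Sum>i<k. \<xi> i \<omega> * (B (min (t (Suc i)) s) \<omega> - B (min (t i) s) \<omega>))"

definition tendsto_in_probability ::
    "'a measure \<Rightarrow> (nat \<Rightarrow> 'a \<Rightarrow> real) \<Rightarrow> ('a \<Rightarrow> real) \<Rightarrow> bool" where
  "tendsto_in_probability M Z Y \<longleftrightarrow>
     (\<forall>\<epsilon>>0. (\<lambda>n. measure M {\<omega> \<in> space M. \<bar>Z n \<omega> - Y \<omega>\<bar> > \<epsilon>}) \<longlonglongrightarrow> 0)"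

definition locally_square_integrable ::
    "'a measure \<Rightarrow> (real \<Rightarrow> 'a measure) \<Rightarrow> (real \<Rightarrow> 'a \<Rightarrow> real) \<Rightarrow> bool" where
  "locally_square_integrable M F H \<longleftrightarrow>
     progressively_measurable F H \<and>
     (AE \<omega> in M. \<forall>T\<ge>0. set_integrable lborel {0..T} (\<lambda>s. (H s \<omega>)\<^sup>2))"

text \<open>
  \<open>is_ito_integral M F B H I\<close>: the process \<open>I\<close> is (a version of) \<open>\<integral>H dB\<close>, i.e. the continuous
  adapted process which at each time is the limit in probability of the integrals of simple
  integrands \<open>H\<^sub>n\<close> with \<open>\<integral>\<^sub>0\<^sup>T (H\<^sub>n - H)\<^sup>2 ds \<rightarrow> 0\<close> in probability for every \<open>T\<close>. By the It\^o isometry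
  such an \<open>I\<close> does not depend, up to indistinguishability, on the approximating sequence.
\<close>

definition is_ito_integral ::
    "'a measure \<Rightarrow> (real \<Rightarrow> 'a measure) \<Rightarrow> (real \<Rightarrow> 'a \<Rightarrow> real) \<Rightarrow>
     (real \<Rightarrow> 'a \<Rightarrow> real) \<Rightarrow> (real \<Rightarrow> 'a \<Rightarrow> real) \<Rightarrow> bool" where
  "is_ito_integral M F B H I \<longleftrightarrow>
     locally_square_integrable M F H \<and> adapted F I \<and> continuous_process M I \<and>
     (\<exists>k t \<xi>. (\<forall>n. simple_integrand F (k n) (t n) (\<xi> n)) \<and>
        (\<forall>T\<ge>0.
           tendsto_in_probability M
             (\<lambda>n \<omega>. LINT s:{0..T}|lborel. (simple_process (k n) (t n) (\<xi> n) s \<omega> - H s \<omega>)\<^sup>2)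
             (\<lambda>_. 0) \<and>
           tendsto_in_probability M (\<lambda>n. simple_integral B (k n) (t n) (\<xi> n) T) (I T)))"

section \<open>Strong solutions\<close>

text \<open>
  Nonnegative strong solutions of \<open>dX\<^sub>t = \<beta>(t, \<omega>, X\<^sub>t) dt + \<gamma>(t, \<omega>, X\<^sub>t) dB\<^sub>t\<close>, \<open>X\<^sub>0 = x\<^sub>0\<close>.
\<close>

definition strong_solution ::
    "'a measure \<Rightarrow> (real \<Rightarrow> 'a measure) \<Rightarrow> (real \<Rightarrow> 'a \<Rightarrow> real) \<Rightarrow>
     (real \<Rightarrow> 'a \<Rightarrow> real \<Rightarrow> real) \<Rightarrow> (real \<Rightarrow> 'a \<Rightarrow> real \<Rightarrow> real) \<Rightarrow> real \<Rightarrow>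
     (real \<Rightarrow> 'a \<Rightarrow> real) \<Rightarrow> bool" where
  "strong_solution M F B \<beta> \<gamma> x0 X \<longleftrightarrow>
     continuous_process M X \<and> adapted F X \<and> (\<forall>t\<ge>0. \<forall>\<omega>\<in>space M. X t \<omega> \<ge> 0) \<and>
     (\<forall>\<omega>\<in>space M. X 0 \<omega> = x0) \<and>
     (\<exists>I. is_ito_integral M F B (\<lambda>t \<omega>. \<gamma> t \<omega> (X t \<omega>)) I \<and>
        (AE \<omega> in M. \<forall>t\<ge>0.
           set_integrable lborel {0..t} (\<lambda>s. \<beta> s \<omega> (X s \<omega>)) \<and>
           X t \<omega> = x0 + (LINT s:{0..t}|lborel. \<beta> s \<omega> (X s \<omega>)) + I t \<omega>))"

section \<open>The equation under consideration\<close>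

definition \<F> :: "(real \<Rightarrow> real) measure \<Rightarrow> real \<Rightarrow> (real \<Rightarrow> real) measure" where
  "\<F> P = augmented_filtration P W"

definition \<C> :: "(real \<Rightarrow> real) measure \<Rightarrow> (real \<Rightarrow> (real \<Rightarrow> real) \<Rightarrow> real) set" where
  "\<C> P = {c. progressively_measurable (\<F> P) c \<and>
     (\<forall>t\<ge>0. \<forall>\<omega>\<in>path_space. c t \<omega> \<ge> 0) \<and>
     (AE \<omega> in completion P. \<forall>t>0. (\<integral>\<^sup>+ s\<in>{0..t}. ennreal (c s \<omega>) \<partial>lborel) < \<infinity>)}"

text \<open>
  Solutions of \<open>dX\<^sub>t = (X\<^sub>t\<^sup>\<alpha> - \<mu>X\<^sub>t - c\<^sub>tX\<^sub>t) dt - \<sigma>X\<^sub>t dW\<^sub>t\<close>, \<open>X\<^sub>0 = 0\<close>. The completion of \<open>P\<close> is used since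
  the \<open>\<F> P t\<close> contain all subsets of \<open>P\<close>-null sets.
\<close>

definition solves_sde ::
    "(real \<Rightarrow> real) measure \<Rightarrow> real \<Rightarrow> real \<Rightarrow> real \<Rightarrow> (real \<Rightarrow> (real \<Rightarrow> real) \<Rightarrow> real) \<Rightarrow>
     (real \<Rightarrow> (real \<Rightarrow> real) \<Rightarrow> real) \<Rightarrow> bool" where
  "solves_sde P \<alpha> \<sigma> \<mu> c X \<longleftrightarrow>
     strong_solution (completion P) (\<F> P) W
       (\<lambda>t \<omega> x. x powr \<alpha> - \<mu> * x - c t \<omega> * x) (\<lambda>t \<omega> x. - \<sigma> * x) 0 X"

definition b_process ::
    "real \<Rightarrow> real \<Rightarrow> real \<Rightarrow> (real \<Rightarrow> (real \<Rightarrow> real) \<Rightarrow> real) \<Rightarrow>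
     real \<Rightarrow> (real \<Rightarrow> real) \<Rightarrow> real" where
  "b_process \<alpha> \<sigma> \<mu> c t \<omega> = - (1 - \<alpha>) * (\<mu> + c t \<omega> + 1/2 * \<sigma>\<^sup>2 * \<alpha>)"

definition G_process ::
    "real \<Rightarrow> real \<Rightarrow> real \<Rightarrow> (real \<Rightarrow> (real \<Rightarrow> real) \<Rightarrow> real) \<Rightarrow>
     real \<Rightarrow> (real \<Rightarrow> real) \<Rightarrow> real" where
  "G_process \<alpha> \<sigma> \<mu> c t \<omega> =
     (let a = 1 - \<alpha> in
        exp ((LINT s:{0..t}|lborel. (- b_process \<alpha> \<sigma> \<mu> c s \<omega> + \<sigma>\<^sup>2 * a\<^sup>2 / 2)) + \<sigma> * a * W t \<omega>))"

definition X_tilde ::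
    "real \<Rightarrow> real \<Rightarrow> real \<Rightarrow> (real \<Rightarrow> (real \<Rightarrow> real) \<Rightarrow> real) \<Rightarrow>
     real \<Rightarrow> (real \<Rightarrow> real) \<Rightarrow> real" where
  "X_tilde \<alpha> \<sigma> \<mu> c t \<omega> =
     (if t = 0 then 0
      else ((1 - \<alpha>) / G_process \<alpha> \<sigma> \<mu> c t \<omega> * (LINT s:{0..t}|lborel. G_process \<alpha> \<sigma> \<mu> c s \<omega>))
             powr (1 / (1 - \<alpha>)))"

end

theory Submission
  imports Defs
begin

text \<open>
  Write \<open>X\<^sub>t = M\<^sub>t Z\<^sub>t\<close> with the exponential martingale \<open>M\<^sub>t = exp (- \<sigma>W\<^sub>t - \<sigma>\<^sup>2t/2)\<close>. For the
  candidate solution, \<open>Z\<^sub>t = exp (- \<integral>\<^sub>0\<^sup>t (\<mu> + c\<^sub>s) ds) (a \<integral>\<^sub>0\<^sup>t G\<^sub>s ds)\<^bsup>1/a\<^esup>\<close> is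
  absolutely continuous with a density \<open>z\<close> for which \<open>M z\<close> is the drift of the equation. On a grid,
  \<open>X\<^sub>i\<^sub>+\<^sub>1 - X\<^sub>i = M\<^sub>i\<^sub>+\<^sub>1 (Z\<^sub>i\<^sub>+\<^sub>1 - Z\<^sub>i) + X\<^sub>i (M\<^sub>i\<^sub>+\<^sub>1 / M\<^sub>i - 1)\<close>.
  The first terms are Riemann--Stieltjes sums converging pathwise to \<open>\<integral> M z ds\<close>. In the second ones
  \<open>M\<^sub>i\<^sub>+\<^sub>1 / M\<^sub>i - 1\<close> differs from \<open>- \<sigma> (W\<^sub>i\<^sub>+\<^sub>1 - W\<^sub>i)\<close> by a centred variable that is independent of the
  past and has variance of the order of the squared step, so that by orthogonality these
  differences sum up to something negligible in \<open>L\<^sup>2\<close>. Hence the sums \<open>\<Sum> - \<sigma> X\<^sub>i (W\<^sub>i\<^sub>+\<^sub>1 - W\<^sub>i)\<close>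
  converge to \<open>X\<^sub>t - \<integral> M z ds\<close>, and no general Ito formula is needed.
\<close>

section \<open>Primitives of locally integrable functions\<close>

text \<open>The factor M carries all the noise, so Z has locally bounded variation and the
  stochastic part shrinks to one explicit function of a Gaussian increment. The control is only
  locally integrable in time, so Z need not be C^1: \<open>is_primitive\<close> keeps an explicit
  density, and chain and product rule are read off from limits of telescoping sums instead of
  derivatives. The form of Z comes from a Bernoulli equation. Once the linear part is divided out,
  h' = h^\<alpha> G remains, and separating variables from the value 0 gives h^a = a times the
  integral of G. The constant h = 0 solves it too, which is the source of non-uniqueness. Since 1/a
  > 1, the power is C^1 up to the point 0 where h starts. Two obstacles shape the rest. Simple
  integrands must be bounded while X need not be, so heights are truncated at a growing level; on
  each path the truncation is eventually inactive. And independence of increments is postulated for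
  the natural filtration only, so it has to be carried over to the augmentation.\<close>

definition is_primitive :: "(real \<Rightarrow> real) \<Rightarrow> (real \<Rightarrow> real) \<Rightarrow> bool" where
  "is_primitive f F \<longleftrightarrow>
     (\<forall>t\<ge>0. set_integrable lborel {0..t} f \<and> F t = F 0 + (LINT s:{0..t}|lborel. f s))"

lemma set_integral_split:
  fixes g :: "real \<Rightarrow> real"
  assumes "set_integrable lborel {a..v} g" "a \<le> u" "u \<le> v"
  shows "(LINT s:{a..v}|lborel. g s) = (LINT s:{a..u}|lborel. g s) + (LINT s:{u..v}|lborel. g s)"
proof -
  have "{a..v} = {a..u} \<union> {u..v}"
    using assms by auto
  moreover have "AE x in lborel. \<not> (x \<in> {a..u} \<and> x \<in> {u..v})"
    by (rule AE_mp[OF AE_lborel_singleton[of u]]) auto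
  moreover have "set_integrable lborel {a..u} g" "set_integrable lborel {u..v} g"
    by (rule set_integrable_subset[OF assms(1)]; use assms in auto)+
  ultimately show ?thesis
    by (simp add: set_integral_Un_AE)
qed

lemma is_primitiveD:
  assumes "is_primitive f F" "0 \<le> t"
  shows "set_integrable lborel {0..t} f" "F t = F 0 + (LINT s:{0..t}|lborel. f s)"
  using assms unfolding is_primitive_def by blast+

lemma is_primitive_set_integrable:
  assumes "is_primitive f F" "0 \<le> u"
  shows "set_integrable lborel {u..v} f"
proof (cases "0 \<le> v")
  case True
  show ?thesis
    by (rule set_integrable_subset[OF is_primitiveD(1)[OF assms(1) True]]) (use assms in auto)
next
  case False
  then show ?thesis using assms(2) by simp
qed

lemma is_primitive_diff:
  assumes "is_primitive f F" "0 \<le> u" "u \<le> v"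
  shows "F v - F u = (LINT s:{u..v}|lborel. f s)"
proof -
  have "0 \<le> v" using assms by simp
  then show ?thesis
    using is_primitiveD(2)[OF assms(1), of u] is_primitiveD(2)[OF assms(1), of v]
      set_integral_split[OF is_primitiveD(1)[OF assms(1), of v], of u] assms
    by simp
qed

lemma is_primitive_LINT:
  assumes "\<And>t. 0 \<le> t \<Longrightarrow> set_integrable lborel {0..t} f"
  shows "is_primitive f (\<lambda>t. LINT s:{0..t}|lborel. f s)"
proof -
  have "(LINT s:{0..0}|lborel. f s) = 0"
    using set_integral_split[OF assms[of 0], of 0] by simp
  with assms show ?thesis
    by (simp add: is_primitive_def)
qed

text \<open>Continuity at x is tested on an interval reaching to x + 1, which contains a
  neighbourhood of x in the half-line.\<close>

lemma continuous_on_atLeastI: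
  fixes F :: "real \<Rightarrow> real"
  assumes "\<And>t. a \<le> t \<Longrightarrow> continuous_on {a..t} F"
  shows "continuous_on {a..} F"
  unfolding continuous_on_eq_continuous_within
proof
  fix x assume x: "x \<in> {a..}"
  have "(F \<longlongrightarrow> F x) (at x within {a..x+1})"
    using assms[of "x + 1"] x by (auto simp: continuous_on_def)
  moreover have "at x within {a..x+1} = at x within {a..}"
    by (rule at_within_nhd[of _ "{x - 1<..<x + 1}"]) auto
  ultimately show "continuous (at x within {a..}) F"
    by (simp add: continuous_within)
qed

lemma is_primitive_continuous_on:
  assumes "is_primitive f F"
  shows "continuous_on {0..} F"
proof (rule continuous_on_atLeastI)
  fix t :: real assume t: "0 \<le> t"
  \<comment> \<open>The indefinite gauge integral is continuous, and it agrees with the Lebesgue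
    integral because \<open>f\<close> is Lebesgue integrable.\<close>
  have "continuous_on {0..t} (\<lambda>x. F 0 + integral {0..x} f)"
    by (intro continuous_intros indefinite_integral_continuous_1
        set_borel_integral_eq_integral(1) is_primitiveD[OF assms t])
  also have "?this \<longleftrightarrow> continuous_on {0..t} F"
  proof (rule continuous_on_cong[OF refl])
    fix x assume "x \<in> {0..t}"
    then have "0 \<le> x" by simp
    from is_primitiveD[OF assms this] show "F 0 + integral {0..x} f = F x"
      by (metis set_borel_integral_eq_integral(2))
  qed
  finally show "continuous_on {0..t} F" .
qed

lemma set_integrable_continuous_mult:
  fixes f g :: "real \<Rightarrow> real"
  assumes f: "continuous_on {a..b} f" and g: "set_integrable lborel {a..b} g"
  shows "set_integrable lborel {a..b} (\<lambda>s. f s * g s)"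
proof -
  obtain C where C: "\<And>s. s \<in> {a..b} \<Longrightarrow> \<bar>f s\<bar> \<le> C"
    using compact_imp_bounded[OF compact_continuous_image[OF f compact_Icc]]
    unfolding bounded_iff by (metis imageI real_norm_def)
  have "set_integrable lborel {a..b} (\<lambda>s. C * g s)"
    using g by simp
  then show ?thesis
  proof (rule set_integrable_bound)
    have "(\<lambda>s. indicator {a..b} s *\<^sub>R f s) \<in> borel_measurable lborel"
      using borel_measurable_continuous_on_indicator[OF _ f] by simp
    moreover have "(\<lambda>s. indicator {a..b} s *\<^sub>R g s) \<in> borel_measurable lborel"
      using g by (simp add: set_integrable_def)
    ultimately have "(\<lambda>s. (indicator {a..b} s *\<^sub>R f s) * (indicator {a..b} s *\<^sub>R g s)) \<in> borel_measurable lborel"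
      by (rule borel_measurable_times)
    moreover have "(indicator {a..b} s *\<^sub>R f s) * (indicator {a..b} s *\<^sub>R g s) = indicator {a..b} s *\<^sub>R (f s * g s)" for s
      by (simp add: indicator_def)
    ultimately show "set_borel_measurable lborel {a..b} (\<lambda>s. f s * g s)"
      unfolding set_borel_measurable_def by (simp only:)
    show "AE x in lborel. x \<in> {a..b} \<longrightarrow> norm (f x * g x) \<le> norm (C * g x)"
      by (intro AE_I2 impI) (auto simp: abs_mult intro!: mult_right_mono order_trans[OF C])
  qed
qed

lemma set_integrable_continuous:
  fixes f :: "real \<Rightarrow> real"
  assumes "continuous_on {a..b} f"
  shows "set_integrable lborel {a..b} f"
  unfolding set_integrable_def
  by (rule borel_integrable_compact[OF compact_Icc assms])

lemma is_primitive_continuous_mult: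
  assumes "continuous_on {0..} f" "is_primitive g F"
  shows "is_primitive (\<lambda>s. f s * g s) (\<lambda>t. LINT s:{0..t}|lborel. f s * g s)"
proof (intro is_primitive_LINT set_integrable_continuous_mult)
  show "continuous_on {0..t} f" for t
    by (rule continuous_on_subset[OF assms(1)]) auto
qed (rule is_primitiveD[OF assms(2)])

lemma is_primitive_continuous_LINT:
  assumes "continuous_on {0..} f"
  shows "is_primitive f (\<lambda>t. LINT s:{0..t}|lborel. f s)"
  by (intro is_primitive_LINT set_integrable_continuous continuous_on_subset[OF assms]) auto

text \<open>
  The mesh \<open>(n + 1)\<^sup>-\<^sup>3\<close> beats the square of the truncation level \<open>n + 1\<close> used for the integrands
  below, and \<open>steps n\<close> steps reach up to time \<open>n + 1\<close>.
\<close>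

definition grid :: "nat \<Rightarrow> nat \<Rightarrow> real" where
  "grid n i = real i / real (Suc n) ^ 3"

definition steps :: "nat \<Rightarrow> nat" where
  "steps n = Suc n ^ 4"

lemma grid_0 [simp]: "grid n 0 = 0"
  by (simp add: grid_def)

lemma grid_nonneg [simp]: "0 \<le> grid n i"
  by (simp add: grid_def)

lemma grid_strict_mono [simp]: "grid n i < grid n (Suc i)"
  by (simp add: grid_def divide_strict_right_mono)

lemma grid_mono: "i \<le> j \<Longrightarrow> grid n i \<le> grid n j"
  by (simp add: grid_def divide_right_mono)

lemma min_grid_mono: "min (grid n i) T \<le> min (grid n (Suc i)) T"
  by (rule min.mono) (simp_all add: grid_mono)

lemma grid_step: "grid n (Suc i) - grid n i = 1 / real (Suc n) ^ 3"
  by (simp add: grid_def diff_divide_distrib[symmetric])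

lemma grid_steps: "grid n (steps n) = real (Suc n)"
proof -
  have "real (Suc n) ^ 4 = real (Suc n) * real (Suc n) ^ 3"
    by (simp only: power_Suc[symmetric]) simp
  then show ?thesis by (simp add: grid_def steps_def del: of_nat_Suc)
qed

lemma eventually_grid_steps: "eventually (\<lambda>n. T \<le> grid n (steps n)) sequentially"
proof -
  obtain N :: nat where "T \<le> real N"
    using real_arch_simple by blast
  then show ?thesis
    by (intro eventually_sequentiallyI[of N]) (simp add: grid_steps)
qed

lemma mesh_tendsto_0: "(\<lambda>n. 1 / real (Suc n) ^ 3) \<longlonglongrightarrow> 0"
  using tendsto_power[OF LIMSEQ_inverse_real_of_nat, of 3]
  by (simp add: inverse_eq_divide power_one_over del: of_nat_Suc)

lemma sum_grid_telescope:
  fixes F :: "real \<Rightarrow> real"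
  assumes "T \<le> grid n (steps n)" "0 \<le> T"
  shows "(\<Sum>i<steps n. F (min (grid n (Suc i)) T) - F (min (grid n i) T)) = F T - F 0"
  using assms sum_lessThan_telescope[of "\<lambda>i. F (min (grid n i) T)" "steps n"]
  by (simp add: min_def)

text \<open>On a cell the increment of \<open>F\<close> is the integral of \<open>g\<close>, so
  freezing \<open>f\<close> at the tag costs at most the oscillation of \<open>f\<close> times the
  integral of |g| over that cell, and these integrals add up to a constant. Tags are arbitrary
  because three choices occur: left ends, right ends, and points supplied by the mean value theorem.
  Cells beyond \<open>T\<close> collapse to the point \<open>T\<close>.\<close>

lemma riemann_stieltjes_limit:
  assumes f: "continuous_on {0..} f" and F: "is_primitive g F" and T: "0 \<le> T"
    and \<tau>: "\<And>n i. \<tau> n i \<in> {min (grid n i) T..min (grid n (Suc i)) T}"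
  shows "(\<lambda>n. \<Sum>i<steps n. f (\<tau> n i) * (F (min (grid n (Suc i)) T) - F (min (grid n i) T)))
           \<longlonglongrightarrow> (LINT s:{0..T}|lborel. f s * g s)"
proof (rule LIMSEQ_I)
  fix e :: real assume e: "0 < e"
  define H where "H t = (LINT s:{0..t}|lborel. f s * g s)" for t
  define K where "K t = (LINT s:{0..t}|lborel. \<bar>g s\<bar>)" for t
  have H: "is_primitive (\<lambda>s. f s * g s) H"
    unfolding H_def by (rule is_primitive_continuous_mult[OF f F])
  have K: "is_primitive (\<lambda>s. \<bar>g s\<bar>) K"
    unfolding K_def by (intro is_primitive_LINT set_integrable_abs is_primitiveD[OF F])
  have K0: "K 0 = 0"
    using is_primitiveD(2)[OF K, of 0] by (simp add: K_def)
  have H0: "H 0 = 0"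
    using is_primitiveD(2)[OF H, of 0] by (simp add: H_def)
  have KT: "0 \<le> K T"
    unfolding K_def set_lebesgue_integral_def by (intro Bochner_Integration.integral_nonneg) auto
  \<comment> \<open>Chosen so that \<open>e' * K T < e\<close>; the summand 1 keeps the denominator
    positive when \<open>K T = 0\<close>.\<close>
  define e' where "e' = e / (2 * (1 + K T))"
  have e': "0 < e'"
    using e KT by (simp add: e'_def)
  have "uniformly_continuous_on {0..T} f"
    by (intro compact_uniformly_continuous continuous_on_subset[OF f]) auto
  then obtain d where d: "0 < d"
    and unif: "\<And>x y. x \<in> {0..T} \<Longrightarrow> y \<in> {0..T} \<Longrightarrow> \<bar>x - y\<bar> < d \<Longrightarrow> \<bar>f x - f y\<bar> < e'"
    using e' unfolding uniformly_continuous_on_def dist_real_def by metis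
  have "eventually (\<lambda>n. 1 / real (Suc n) ^ 3 < d) sequentially"
    using order_tendstoD(2)[OF mesh_tendsto_0 d] .
  moreover note eventually_grid_steps[of T]
  ultimately have "eventually (\<lambda>n. \<bar>(\<Sum>i<steps n. f (\<tau> n i) *
      (F (min (grid n (Suc i)) T) - F (min (grid n i) T))) - H T\<bar> < e) sequentially"
  proof eventually_elim
    case (elim n)
    let ?u = "\<lambda>i. min (grid n i) T"
    have step: "\<bar>f (\<tau> n i) * (F (?u (Suc i)) - F (?u i)) - (H (?u (Suc i)) - H (?u i))\<bar>
        \<le> e' * (K (?u (Suc i)) - K (?u i))" for i
    proof -
      have uv: "0 \<le> ?u i" "?u i \<le> ?u (Suc i)" "?u (Suc i) \<le> T"
        using T less_imp_le[OF grid_strict_mono[of n i]] by (auto simp: min_def)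
      have close: "?u (Suc i) - ?u i < d"
        using grid_step[of n i] elim(1) grid_strict_mono[of n i] d by (auto simp: min_def)
      have ig: "set_integrable lborel {?u i..?u (Suc i)} g"
        by (rule is_primitive_set_integrable[OF F uv(1)])
      have ifg: "set_integrable lborel {?u i..?u (Suc i)} (\<lambda>s. f s * g s)"
        by (rule is_primitive_set_integrable[OF H uv(1)])
      have iabs: "set_integrable lborel {?u i..?u (Suc i)} (\<lambda>s. \<bar>g s\<bar>)"
        by (rule is_primitive_set_integrable[OF K uv(1)])
      have "f (\<tau> n i) * (F (?u (Suc i)) - F (?u i)) - (H (?u (Suc i)) - H (?u i))
          = (LINT s:{?u i..?u (Suc i)}|lborel. f (\<tau> n i) * g s - f s * g s)"
        using is_primitive_diff[OF F uv(1,2)] is_primitive_diff[OF H uv(1,2)] ig ifg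
        by (simp add: set_integral_diff)
      also have "\<bar>\<dots>\<bar> \<le> (LINT s:{?u i..?u (Suc i)}|lborel. \<bar>f (\<tau> n i) * g s - f s * g s\<bar>)"
        using set_integral_norm_bound[of lborel "{?u i..?u (Suc i)}" "\<lambda>s. f (\<tau> n i) * g s - f s * g s"] ig ifg
        by (simp add: set_integral_diff)
      also have "\<dots> \<le> (LINT s:{?u i..?u (Suc i)}|lborel. e' * \<bar>g s\<bar>)"
      proof (rule set_integral_mono)
        show "set_integrable lborel {?u i..?u (Suc i)} (\<lambda>s. \<bar>f (\<tau> n i) * g s - f s * g s\<bar>)"
          using ig ifg by (intro set_integrable_abs set_integral_diff) auto
        show "set_integrable lborel {?u i..?u (Suc i)} (\<lambda>s. e' * \<bar>g s\<bar>)"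
          using iabs by simp
        fix s assume s: "s \<in> {?u i..?u (Suc i)}"
        have "\<bar>f (\<tau> n i) - f s\<bar> < e'"
        proof (rule unif)
          show "\<tau> n i \<in> {0..T}" using order_trans[OF uv(1)] \<tau>[of n i] uv by (metis atLeastAtMost_iff order_trans)
          show "s \<in> {0..T}" using order_trans[OF uv(1)] s uv by (metis atLeastAtMost_iff order_trans)
          show "\<bar>\<tau> n i - s\<bar> < d" using s \<tau>[of n i] close by auto
        qed
        then show "\<bar>f (\<tau> n i) * g s - f s * g s\<bar> \<le> e' * \<bar>g s\<bar>"
          by (simp add: left_diff_distrib[symmetric] abs_mult mult_right_mono)
      qed
      also have "\<dots> = e' * (K (?u (Suc i)) - K (?u i))"
        using is_primitive_diff[OF K uv(1,2)] by simp
      finally show ?thesis .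
    qed
    have "\<bar>(\<Sum>i<steps n. f (\<tau> n i) * (F (?u (Suc i)) - F (?u i))) - H T\<bar>
        = \<bar>\<Sum>i<steps n. f (\<tau> n i) * (F (?u (Suc i)) - F (?u i)) - (H (?u (Suc i)) - H (?u i))\<bar>"
      using sum_grid_telescope[OF elim(2) T, of H] H0 by (simp add: sum_subtractf)
    also have "\<dots> \<le> (\<Sum>i<steps n. e' * (K (?u (Suc i)) - K (?u i)))"
      by (rule order_trans[OF sum_abs sum_mono]) (rule step)
    also have "\<dots> = e' * K T"
      using sum_grid_telescope[OF elim(2) T, of K] K0 by (simp add: sum_distrib_left[symmetric])
    also have "\<dots> < e"
      using e KT add_nonneg_pos[OF mult_nonneg_nonneg[of e "K T"], of "e * 2"] by (simp add: e'_def field_simps)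
    finally show ?case .
  qed
  then show "\<exists>no. \<forall>n\<ge>no. norm ((\<Sum>i<steps n. f (\<tau> n i) * (F (min (grid n (Suc i)) T)
      - F (min (grid n i) T))) - (LINT s:{0..T}|lborel. f s * g s)) < e"
    by (simp add: eventually_sequentially H_def)
qed

section \<open>Chain rule and product rule for primitives\<close>

text \<open>The mean value theorem yields a value strictly between \<open>F u\<close> and
  \<open>F v\<close>, hence positive, and the intermediate value theorem a time at which
  \<open>F\<close> takes it. Thus only continuity of \<open>F\<close> is involved, and
  \<open>\<phi>\<close> is differentiated away from 0.\<close>

lemma mean_value_tag:
  fixes F \<phi> \<phi>' :: "real \<Rightarrow> real"
  assumes F: "continuous_on {u..v} F" "\<And>t. t \<in> {u..v} \<Longrightarrow> 0 \<le> F t" and "u \<le> v"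
    and \<phi>: "continuous_on {0..} \<phi>" "\<And>x. 0 < x \<Longrightarrow> (\<phi> has_real_derivative \<phi>' x) (at x)"
  shows "\<exists>\<tau>\<in>{u..v}. \<phi> (F v) - \<phi> (F u) = \<phi>' (F \<tau>) * (F v - F u)"
proof -
  have mvt: "\<exists>z\<in>{x<..<y}. \<phi> y - \<phi> x = \<phi>' z * (y - x)" if "0 \<le> x" "x < y" for x y
  proof -
    have "continuous_on {x..y} \<phi>"
      by (rule continuous_on_subset[OF \<phi>(1)]) (use that in auto)
    moreover have "(\<phi> has_derivative (\<lambda>h. h * \<phi>' z)) (at z)" if "x < z" "z < y" for z
      using \<phi>(2)[of z] that \<open>0 \<le> x\<close> by (simp add: has_field_derivative_def mult_commute_abs)
    ultimately obtain z where "x < z" "z < y" "\<phi> y - \<phi> x = (y - x) * \<phi>' z"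
      using mvt[OF \<open>x < y\<close>, of \<phi> "\<lambda>z h. h * \<phi>' z"] by blast
    then show ?thesis by (auto simp: mult.commute)
  qed
  have uv: "0 \<le> F u" "0 \<le> F v" using F(2) \<open>u \<le> v\<close> by auto
  consider "F u = F v" | "F u < F v" | "F v < F u" by linarith
  then show ?thesis
  proof cases
    case 1
    then show ?thesis using \<open>u \<le> v\<close> by auto
  next
    case 2
    from mvt[OF uv(1) 2] obtain z where z: "F u < z" "z < F v" "\<phi> (F v) - \<phi> (F u) = \<phi>' z * (F v - F u)"
      by auto
    with IVT'[of F u z v] F(1) \<open>u \<le> v\<close> obtain \<tau> where "u \<le> \<tau>" "\<tau> \<le> v" "F \<tau> = z" by force
    with z(3) show ?thesis by auto
  next
    case 3
    from mvt[OF uv(2) 3] obtain z where z: "F v < z" "z < F u" "\<phi> (F u) - \<phi> (F v) = \<phi>' z * (F u - F v)"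
      by auto
    with IVT2'[of F v z u] F(1) \<open>u \<le> v\<close> obtain \<tau> where "u \<le> \<tau>" "\<tau> \<le> v" "F \<tau> = z" by force
    with z(3) show ?thesis by (intro bexI[of _ \<tau>]) (auto simp: algebra_simps)
  qed
qed

text \<open>With the tags of \<open>mean_value_tag\<close>, the telescoping sum of
  \<open>\<phi> (F t)\<close> is exactly a Riemann-Stieltjes sum of \<open>\<phi>' (F t)\<close>
  against \<open>F\<close>. Continuity of \<open>\<phi>'\<close> up to 0 allows \<open>F\<close> to
  start at 0, as the integral of G does.\<close>

lemma is_primitive_compose:
  assumes F: "is_primitive f F" "\<And>t. 0 \<le> t \<Longrightarrow> 0 \<le> F t"
    and \<phi>: "continuous_on {0..} \<phi>" "\<And>x. 0 < x \<Longrightarrow> (\<phi> has_real_derivative \<phi>' x) (at x)"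
    and \<phi>': "continuous_on {0..} \<phi>'"
  shows "is_primitive (\<lambda>t. \<phi>' (F t) * f t) (\<lambda>t. \<phi> (F t))"
proof -
  note cF = is_primitive_continuous_on[OF F(1)]
  have c: "continuous_on {0..} (\<lambda>t. \<phi>' (F t))"
    by (rule continuous_on_compose2[OF \<phi>' cF]) (use F(2) in auto)
  have "\<phi> (F T) = \<phi> (F 0) + (LINT s:{0..T}|lborel. \<phi>' (F s) * f s)" if T: "0 \<le> T" for T
  proof -
    have "\<exists>\<tau>\<in>{min (grid n i) T..min (grid n (Suc i)) T}.
        \<phi> (F (min (grid n (Suc i)) T)) - \<phi> (F (min (grid n i) T))
          = \<phi>' (F \<tau>) * (F (min (grid n (Suc i)) T) - F (min (grid n i) T))" for n i
    proof (rule mean_value_tag[OF _ _ _ \<phi>])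
      have u: "0 \<le> min (grid n i) T"
        using T by simp
      then show "continuous_on {min (grid n i) T..min (grid n (Suc i)) T} F"
        by (intro continuous_on_subset[OF cF]) auto
      show "0 \<le> F t" if "t \<in> {min (grid n i) T..min (grid n (Suc i)) T}" for t
        using F(2)[OF order_trans[OF u]] that by simp
      show "min (grid n i) T \<le> min (grid n (Suc i)) T"
        using grid_mono[of i "Suc i" n] by simp
    qed
    then obtain \<tau> where \<tau>: "\<And>n i. \<tau> n i \<in> {min (grid n i) T..min (grid n (Suc i)) T}"
      and eq: "\<And>n i. \<phi> (F (min (grid n (Suc i)) T)) - \<phi> (F (min (grid n i) T))
          = \<phi>' (F (\<tau> n i)) * (F (min (grid n (Suc i)) T) - F (min (grid n i) T))"
      by metis
    have "(\<lambda>n. \<Sum>i<steps n. \<phi> (F (min (grid n (Suc i)) T)) - \<phi> (F (min (grid n i) T)))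
        \<longlonglongrightarrow> (LINT s:{0..T}|lborel. \<phi>' (F s) * f s)"
      unfolding eq by (rule riemann_stieltjes_limit[OF c F(1) T \<tau>])
    moreover have "(\<lambda>n. \<Sum>i<steps n. \<phi> (F (min (grid n (Suc i)) T)) - \<phi> (F (min (grid n i) T)))
        \<longlonglongrightarrow> \<phi> (F T) - \<phi> (F 0)"
      by (rule tendsto_eventually, rule eventually_mono[OF eventually_grid_steps[of T]])
        (rule sum_grid_telescope[OF _ T, of _ "\<lambda>t. \<phi> (F t)"])
    ultimately have "\<phi> (F T) - \<phi> (F 0) = (LINT s:{0..T}|lborel. \<phi>' (F s) * f s)"
      using LIMSEQ_unique by blast
    then show ?thesis by linarith
  qed
  then show ?thesis
    using is_primitiveD(1)[OF is_primitive_continuous_mult[OF c F(1)]]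
    unfolding is_primitive_def by blast
qed

text \<open>Abel summation: taking one factor at the right end and the other at the left end makes
  the discrete product rule exact, with no quadratic cross term to estimate.\<close>

lemma is_primitive_mult:
  assumes F: "is_primitive f F" and G: "is_primitive g G"
  shows "is_primitive (\<lambda>t. F t * g t + G t * f t) (\<lambda>t. F t * G t)"
proof -
  note cF = is_primitive_continuous_on[OF F] and cG = is_primitive_continuous_on[OF G]
  note iFg = is_primitiveD(1)[OF is_primitive_continuous_mult[OF cF G]]
  note iGf = is_primitiveD(1)[OF is_primitive_continuous_mult[OF cG F]]
  have "F T * G T = F 0 * G 0 + (LINT s:{0..T}|lborel. F s * g s + G s * f s)" if T: "0 \<le> T" for T
  proof -
    let ?v = "\<lambda>n i. min (grid n i) T"
    have "(\<lambda>n. \<Sum>i<steps n. F (?v n (Suc i)) * (G (?v n (Suc i)) - G (?v n i)))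
        \<longlonglongrightarrow> (LINT s:{0..T}|lborel. F s * g s)"
      by (rule riemann_stieltjes_limit[OF cF G T, where \<tau>="\<lambda>n i. ?v n (Suc i)"])
        (simp only: atLeastAtMost_iff min_grid_mono order_refl simp_thms)
    moreover have "(\<lambda>n. \<Sum>i<steps n. G (?v n i) * (F (?v n (Suc i)) - F (?v n i)))
        \<longlonglongrightarrow> (LINT s:{0..T}|lborel. G s * f s)"
      by (rule riemann_stieltjes_limit[OF cG F T, where \<tau>="\<lambda>n i. ?v n i"])
        (simp only: atLeastAtMost_iff min_grid_mono order_refl simp_thms)
    ultimately have "(\<lambda>n. (\<Sum>i<steps n. F (?v n (Suc i)) * (G (?v n (Suc i)) - G (?v n i)))
          + (\<Sum>i<steps n. G (?v n i) * (F (?v n (Suc i)) - F (?v n i))))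
        \<longlonglongrightarrow> (LINT s:{0..T}|lborel. F s * g s) + (LINT s:{0..T}|lborel. G s * f s)"
      by (rule tendsto_add)
    also have "(\<lambda>n. (\<Sum>i<steps n. F (?v n (Suc i)) * (G (?v n (Suc i)) - G (?v n i)))
          + (\<Sum>i<steps n. G (?v n i) * (F (?v n (Suc i)) - F (?v n i))))
        = (\<lambda>n. \<Sum>i<steps n. F (?v n (Suc i)) * G (?v n (Suc i)) - F (?v n i) * G (?v n i))"
      unfolding sum.distrib[symmetric] by (intro ext sum.cong refl) (simp add: algebra_simps)
    finally have lim: "(\<lambda>n. \<Sum>i<steps n. F (?v n (Suc i)) * G (?v n (Suc i)) - F (?v n i) * G (?v n i))
        \<longlonglongrightarrow> (LINT s:{0..T}|lborel. F s * g s) + (LINT s:{0..T}|lborel. G s * f s)" .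
    have "(\<lambda>n. \<Sum>i<steps n. F (?v n (Suc i)) * G (?v n (Suc i)) - F (?v n i) * G (?v n i))
        \<longlonglongrightarrow> F T * G T - F 0 * G 0"
      by (rule tendsto_eventually, rule eventually_mono[OF eventually_grid_steps[of T]])
        (rule sum_grid_telescope[OF _ T, of _ "\<lambda>t. F t * G t"])
    from LIMSEQ_unique[OF this lim]
    have "F T * G T - F 0 * G 0 = (LINT s:{0..T}|lborel. F s * g s) + (LINT s:{0..T}|lborel. G s * f s)" .
    also have "\<dots> = (LINT s:{0..T}|lborel. F s * g s + G s * f s)"
      by (rule set_integral_add(2)[symmetric]) (rule iFg[OF T] iGf[OF T])+
    finally show ?thesis by linarith
  qed
  moreover have "set_integrable lborel {0..T} (\<lambda>s. F s * g s + G s * f s)" if "0 \<le> T" for T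
    by (rule set_integral_add(1)) (rule iFg[OF that] iGf[OF that])+
  ultimately show ?thesis
    unfolding is_primitive_def by blast
qed

section \<open>Convergence in probability and progressive measurability\<close>

text \<open>Simple integrands are required to have bounded heights, whereas the value of a solution
  at a grid time need not be bounded in \<omega>.\<close>

definition clip :: "real \<Rightarrow> real \<Rightarrow> real" where
  "clip K x = max (- K) (min K x)"

lemma abs_clip_le: "0 \<le> K \<Longrightarrow> \<bar>clip K x\<bar> \<le> K"
  by (auto simp: clip_def)

lemma clip_eq: "\<bar>x\<bar> \<le> K \<Longrightarrow> clip K x = x"
  by (auto simp: clip_def)

lemma borel_measurable_clip [measurable]: "clip K \<in> borel_measurable borel"
  unfolding clip_def by measurable

lemma sum_indicator_grid:
  fixes a :: "nat \<Rightarrow> real"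
  assumes "s \<in> {grid n j<..grid n (Suc j)}" "j < k"
  shows "(\<Sum>i<k. a i * indicator {grid n i<..grid n (Suc i)} s) = a j"
proof -
  have "a i * indicator {grid n i<..grid n (Suc i)} s = (if i = j then a i else 0)" for i
  proof (cases i j rule: linorder_cases)
    case less
    then have "grid n (Suc i) \<le> grid n j" by (intro grid_mono) simp
    with less assms show ?thesis by (simp add: indicator_def)
  next
    case greater
    then have "grid n (Suc j) \<le> grid n i" by (intro grid_mono) simp
    with greater assms show ?thesis by (simp add: indicator_def)
  qed (use assms in simp)
  then show ?thesis
    using assms(2) by simp
qed

lemma grid_cell:
  assumes "0 < s" "s \<le> grid n k"
  obtains j where "j < k" "s \<in> {grid n j<..grid n (Suc j)}"
proof -
  define i where "i = (LEAST i. s \<le> grid n i)"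
  have i: "s \<le> grid n i" "i \<le> k"
    unfolding i_def by (rule LeastI[of _ k], fact, rule Least_le, fact)
  have "i \<noteq> 0"
    using i(1) assms(1) by (intro notI) simp
  then obtain j where j: "i = Suc j"
    by (cases i) auto
  then have "\<not> s \<le> grid n j"
    using not_less_Least[of j "\<lambda>i. s \<le> grid n i"] by (simp add: i_def)
  with i j that[of j] show ?thesis by auto
qed

lemma continuous_bounded_Icc:
  fixes f :: "real \<Rightarrow> real"
  assumes "continuous_on {0..} f"
  shows "\<exists>C. \<forall>s\<in>{0..T}. \<bar>f s\<bar> \<le> C"
proof -
  have "bounded (f ` {0..T})"
    by (intro compact_imp_bounded compact_continuous_image continuous_on_subset[OF assms]) auto
  then show ?thesis
    unfolding bounded_iff by (metis imageI real_norm_def)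
qed

text \<open>A continuous path is bounded on [0, T], so the level n + 1 passes its bound. The
  threshold depends on the path, which is enough for almost sure convergence.\<close>

lemma eventually_clip_grid:
  fixes f :: "real \<Rightarrow> real"
  assumes "continuous_on {0..} f"
  shows "eventually (\<lambda>n. \<forall>s\<in>{0..T}. clip (real (Suc n)) (f s) = f s) sequentially"
proof -
  obtain C where C: "\<And>s. s \<in> {0..T} \<Longrightarrow> \<bar>f s\<bar> \<le> C"
    using continuous_bounded_Icc[OF assms] by blast
  obtain N :: nat where N: "C \<le> real N"
    using real_arch_simple by blast
  have "clip (real (Suc n)) (f s) = f s" if "N \<le> n" "s \<in> {0..T}" for n s
  proof (rule clip_eq)
    have "real N \<le> real (Suc n)" using that(1) by simp
    then show "\<bar>f s\<bar> \<le> real (Suc n)" using C[OF that(2)] N by linarith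
  qed
  then show ?thesis
    by (intro eventually_sequentiallyI[of N]) blast
qed

text \<open>This is the pathwise source of the approximation demanded by
  \<open>is_ito_integral\<close>: uniform continuity makes the left-end step functions uniformly
  close to \<open>f\<close> on (0, T], once the truncation is inactive.\<close>

lemma clipped_grid_L2_limit:
  assumes f: "continuous_on {0..} f" and T: "0 \<le> T"
  shows "(\<lambda>n. LINT s:{0..T}|lborel. ((\<Sum>i<steps n. clip (real (Suc n)) (f (grid n i)) *
             indicator {grid n i<..grid n (Suc i)} s) - f s)\<^sup>2) \<longlonglongrightarrow> 0"
proof (rule LIMSEQ_I)
  let ?g = "\<lambda>n s. (\<Sum>i<steps n. clip (real (Suc n)) (f (grid n i)) *
             indicator {grid n i<..grid n (Suc i)} s) - f s"
  fix e :: real assume e: "0 < e"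
  \<comment> \<open>A uniform error below this value gives an integral of squares below
    \<open>e\<close>, also when \<open>T = 0\<close>.\<close>
  define e' where "e' = sqrt (e / (2 * (1 + T)))"
  have e': "0 < e'" "e'\<^sup>2 * T < e"
  proof -
    show "0 < e'" using e T by (simp add: e'_def)
    have "e'\<^sup>2 * T = e * T / (2 * (1 + T))"
      using e T by (simp add: e'_def)
    also have "\<dots> < e"
      using e T mult_nonneg_nonneg[of T e] by (simp add: divide_less_eq algebra_simps add_nonneg_pos)
    finally show "e'\<^sup>2 * T < e" .
  qed
  have "uniformly_continuous_on {0..T} f"
    by (intro compact_uniformly_continuous continuous_on_subset[OF f]) auto
  then obtain d where d: "0 < d"
    and unif: "\<And>x y. x \<in> {0..T} \<Longrightarrow> y \<in> {0..T} \<Longrightarrow> \<bar>x - y\<bar> < d \<Longrightarrow> \<bar>f x - f y\<bar> < e'"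
    using e'(1) unfolding uniformly_continuous_on_def dist_real_def by metis
  have "eventually (\<lambda>n. 1 / real (Suc n) ^ 3 < d) sequentially"
    using order_tendstoD(2)[OF mesh_tendsto_0 d] .
  moreover note eventually_grid_steps[of T] eventually_clip_grid[OF f, of T]
  ultimately have "eventually (\<lambda>n. \<bar>LINT s:{0..T}|lborel. (?g n s)\<^sup>2\<bar> < e) sequentially"
  proof eventually_elim
    case (elim n)
    have bound: "(?g n s)\<^sup>2 \<le> e'\<^sup>2" if s: "s \<in> {0<..T}" for s
    proof -
      obtain j where j: "j < steps n" "s \<in> {grid n j<..grid n (Suc j)}"
        using grid_cell[of s n "steps n"] s elim(2) by auto
      have gj: "grid n j \<in> {0..T}"
        using j s by auto
      have "\<bar>f (grid n j) - f s\<bar> < e'"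
        using j s gj elim(1) grid_step[of n j] by (intro unif) auto
      moreover have "?g n s = f (grid n j) - f s"
        using elim(3) gj by (simp add: sum_indicator_grid[OF j(2,1)])
      ultimately show ?thesis
        by (metis abs_ge_zero less_imp_le power2_abs power_mono)
    qed
    have "0 \<le> (LINT s:{0..T}|lborel. (?g n s)\<^sup>2)"
      unfolding set_lebesgue_integral_def by (intro Bochner_Integration.integral_nonneg) auto
    moreover have "(LINT s:{0..T}|lborel. (?g n s)\<^sup>2) \<le> (LINT s:{0..T}|lborel. e'\<^sup>2)"
      unfolding set_lebesgue_integral_def
    proof (rule integral_mono_AE')
      show "integrable lborel (\<lambda>s. indicator {0..T} s *\<^sub>R e'\<^sup>2)"
        using set_integrable_continuous[OF continuous_on_const, of 0 T "e'\<^sup>2"]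
        unfolding set_integrable_def .
      \<comment> \<open>Cells are open on the left, so time 0 lies in none of them; it is discarded
        as a null set.\<close>
      show "AE s in lborel. indicator {0..T} s *\<^sub>R (?g n s)\<^sup>2 \<le> indicator {0..T} s *\<^sub>R e'\<^sup>2"
        using AE_lborel_singleton[of 0]
      proof eventually_elim
        case (elim s)
        then show ?case using bound[of s] by (auto simp: indicator_def)
      qed
    qed auto
    moreover have "(LINT s:{0..T}|lborel. e'\<^sup>2) = e'\<^sup>2 * T"
      using T by (simp add: set_lebesgue_integral_def)
    ultimately show ?case
      using e'(2) by simp
  qed
  then show "\<exists>no. \<forall>n\<ge>no. norm ((LINT s:{0..T}|lborel. (?g n s)\<^sup>2) - 0) < e"
    by (simp add: eventually_sequentially)
qed

section \<open>Criteria for convergence in probability\<close>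

text \<open>Dominated convergence for the indicators of the exceptional events.\<close>

lemma (in finite_measure) tendsto_in_probability_AE:
  assumes [measurable]: "\<And>n. Z n \<in> borel_measurable M" "Y \<in> borel_measurable M"
    and lim: "AE \<omega> in M. (\<lambda>n. Z n \<omega>) \<longlonglongrightarrow> Y \<omega>"
  shows "tendsto_in_probability M Z Y"
  unfolding tendsto_in_probability_def
proof (intro allI impI)
  fix e :: real assume e: "0 < e"
  let ?A = "\<lambda>n. {\<omega> \<in> space M. e < \<bar>Z n \<omega> - Y \<omega>\<bar>}"
  have "(\<lambda>n. \<integral>\<omega>. indicator (?A n) \<omega> \<partial>M) \<longlonglongrightarrow> (\<integral>\<omega>. (0::real) \<partial>M)"
  proof (rule integral_dominated_convergence)
    show "AE \<omega> in M. (\<lambda>n. indicator (?A n) \<omega> :: real) \<longlonglongrightarrow> 0"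
      using lim
    proof eventually_elim
      case (elim \<omega>)
      then have "eventually (\<lambda>n. \<bar>Z n \<omega> - Y \<omega>\<bar> < e) sequentially"
        using e by (auto dest!: tendstoD simp: dist_real_def)
      then show ?case
        by (intro tendsto_eventually) (auto elim!: eventually_mono simp: indicator_def)
    qed
    show "integrable M (\<lambda>_. 1 :: real)" by simp
  qed (auto simp: indicator_def)
  then show "(\<lambda>n. measure M (?A n)) \<longlonglongrightarrow> 0"
    by simp
qed

text \<open>Chebyshev's inequality.\<close>

lemma (in finite_measure) tendsto_in_probability_L2:
  assumes [measurable]: "\<And>n. Z n \<in> borel_measurable M"
    and int: "\<And>n. integrable M (\<lambda>\<omega>. (Z n \<omega>)\<^sup>2)"
    and lim: "(\<lambda>n. \<integral>\<omega>. (Z n \<omega>)\<^sup>2 \<partial>M) \<longlonglongrightarrow> 0"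
  shows "tendsto_in_probability M Z (\<lambda>_. 0)"
  unfolding tendsto_in_probability_def
proof (intro allI impI)
  fix e :: real assume e: "0 < e"
  have "measure M {\<omega> \<in> space M. e < \<bar>Z n \<omega> - 0\<bar>} \<le> (\<integral>\<omega>. (Z n \<omega>)\<^sup>2 \<partial>M) / e\<^sup>2" for n
  proof -
    have "measure M {\<omega> \<in> space M. e < \<bar>Z n \<omega> - 0\<bar>} \<le> measure M {\<omega> \<in> space M. e\<^sup>2 \<le> (Z n \<omega>)\<^sup>2}"
    proof (rule finite_measure_mono)
      show "{\<omega> \<in> space M. e < \<bar>Z n \<omega> - 0\<bar>} \<subseteq> {\<omega> \<in> space M. e\<^sup>2 \<le> (Z n \<omega>)\<^sup>2}"
        using e by (auto simp: abs_le_square_iff[symmetric])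
    qed measurable
    also have "\<dots> \<le> (\<integral>\<omega>. (Z n \<omega>)\<^sup>2 \<partial>M) / e\<^sup>2"
      using e by (intro integral_Markov_inequality_measure[where A="{}"] int) auto
    finally show ?thesis .
  qed
  then have "eventually (\<lambda>n. norm (measure M {\<omega> \<in> space M. e < \<bar>Z n \<omega> - 0\<bar>})
      \<le> (\<integral>\<omega>. (Z n \<omega>)\<^sup>2 \<partial>M) / e\<^sup>2) sequentially"
    by (intro always_eventually allI) (simp only: real_norm_def abs_of_nonneg[OF measure_nonneg])
  moreover have "(\<lambda>n. (\<integral>\<omega>. (Z n \<omega>)\<^sup>2 \<partial>M) / e\<^sup>2) \<longlonglongrightarrow> 0"
    using tendsto_divide[OF lim tendsto_const[of "e\<^sup>2"]] e by simp
  ultimately show "(\<lambda>n. measure M {\<omega> \<in> space M. e < \<bar>Z n \<omega> - 0\<bar>}) \<longlonglongrightarrow> 0"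
    by (rule Lim_null_comparison)
qed

text \<open>An error above e in the sum forces an error above e/2 in one of the summands.\<close>

lemma (in finite_measure) tendsto_in_probability_add:
  assumes [measurable]: "\<And>n. Z n \<in> borel_measurable M" "\<And>n. Z' n \<in> borel_measurable M"
      "Y \<in> borel_measurable M" "Y' \<in> borel_measurable M"
    and lim: "tendsto_in_probability M Z Y" "tendsto_in_probability M Z' Y'"
  shows "tendsto_in_probability M (\<lambda>n \<omega>. Z n \<omega> + Z' n \<omega>) (\<lambda>\<omega>. Y \<omega> + Y' \<omega>)"
  unfolding tendsto_in_probability_def
proof (intro allI impI)
  fix e :: real assume e: "0 < e"
  let ?A = "\<lambda>Z Y n. {\<omega> \<in> space M. e / 2 < \<bar>Z n \<omega> - Y \<omega>\<bar>}"
  have "measure M {\<omega> \<in> space M. e < \<bar>Z n \<omega> + Z' n \<omega> - (Y \<omega> + Y' \<omega>)\<bar>}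
      \<le> measure M (?A Z Y n) + measure M (?A Z' Y' n)" for n
  proof -
    have "measure M {\<omega> \<in> space M. e < \<bar>Z n \<omega> + Z' n \<omega> - (Y \<omega> + Y' \<omega>)\<bar>}
        \<le> measure M (?A Z Y n \<union> ?A Z' Y' n)"
    proof (rule finite_measure_mono)
      show "{\<omega> \<in> space M. e < \<bar>Z n \<omega> + Z' n \<omega> - (Y \<omega> + Y' \<omega>)\<bar>} \<subseteq> ?A Z Y n \<union> ?A Z' Y' n"
        by (auto simp: abs_if split: if_splits)
    qed measurable
    also have "\<dots> \<le> measure M (?A Z Y n) + measure M (?A Z' Y' n)"
      by (intro measure_Un_le) auto
    finally show ?thesis .
  qed
  then have "eventually (\<lambda>n. norm (measure M {\<omega> \<in> space M. e < \<bar>Z n \<omega> + Z' n \<omega> - (Y \<omega> + Y' \<omega>)\<bar>})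
      \<le> measure M (?A Z Y n) + measure M (?A Z' Y' n)) sequentially"
    by (intro always_eventually allI) (simp only: real_norm_def abs_of_nonneg[OF measure_nonneg])
  moreover have "(\<lambda>n. measure M (?A Z Y n) + measure M (?A Z' Y' n)) \<longlonglongrightarrow> 0"
    using lim half_gt_zero[OF e] unfolding tendsto_in_probability_def by (intro tendsto_add_zero) blast+
  ultimately show "(\<lambda>n. measure M {\<omega> \<in> space M. e < \<bar>Z n \<omega> + Z' n \<omega> - (Y \<omega> + Y' \<omega>)\<bar>}) \<longlonglongrightarrow> 0"
    by (rule Lim_null_comparison)
qed

section \<open>Closure properties of progressive measurability\<close>

lemma progressively_measurableD:
  assumes "progressively_measurable F X" "0 \<le> t"
  shows "(\<lambda>p. X (fst p) (snd p)) \<in> borel_measurable (restrict_space borel {0..t} \<Otimes>\<^sub>M F t)"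
  using assms unfolding progressively_measurable_def by (simp add: case_prod_beta')

lemma progressively_measurableI:
  assumes "\<And>t. 0 \<le> t \<Longrightarrow> (\<lambda>p. X (fst p) (snd p)) \<in> borel_measurable (restrict_space borel {0..t} \<Otimes>\<^sub>M F t)"
  shows "progressively_measurable F X"
  unfolding progressively_measurable_def case_prod_beta' using assms by blast

lemma progressively_measurable_adapted:
  assumes "progressively_measurable F X"
  shows "adapted F X"
  unfolding adapted_def
proof (intro allI impI)
  fix t :: real assume t: "0 \<le> t"
  have "(\<lambda>\<omega>. (t, \<omega>)) \<in> F t \<rightarrow>\<^sub>M restrict_space borel {0..t} \<Otimes>\<^sub>M F t"
    using t by (intro measurable_Pair measurable_const measurable_ident_sets[OF refl]) (auto simp: space_restrict_space)
  from measurable_compose[OF this progressively_measurableD[OF assms t]]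
  show "X t \<in> borel_measurable (F t)" by simp
qed

lemma progressively_measurable_path:
  assumes "progressively_measurable F X" "0 \<le> t" "\<omega> \<in> space (F t)"
  shows "set_borel_measurable lborel {0..t} (\<lambda>s. X s \<omega>)"
proof -
  have "(\<lambda>s. (s, \<omega>)) \<in> restrict_space borel {0..t} \<rightarrow>\<^sub>M restrict_space borel {0..t} \<Otimes>\<^sub>M F t"
    by (intro measurable_Pair measurable_const measurable_ident_sets[OF refl] assms)
  from measurable_compose[OF this progressively_measurableD[OF assms(1,2)]]
  show ?thesis
    by (simp add: set_borel_measurable_def borel_measurable_restrict_space_iff mult.commute)
qed

lemma progressively_measurable_compose:
  assumes "progressively_measurable F X" "\<phi> \<in> borel_measurable borel"
  shows "progressively_measurable F (\<lambda>t \<omega>. \<phi> (X t \<omega>))"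
  by (rule progressively_measurableI, rule measurable_compose[OF progressively_measurableD[OF assms(1)] assms(2)])

lemma progressively_measurable_add:
  assumes "progressively_measurable F X" "progressively_measurable F Y"
  shows "progressively_measurable F (\<lambda>t \<omega>. X t \<omega> + Y t \<omega>)"
  by (rule progressively_measurableI, rule borel_measurable_add)
    (rule progressively_measurableD[OF assms(1)] progressively_measurableD[OF assms(2)]; assumption)+

lemma progressively_measurable_mult:
  assumes "progressively_measurable F X" "progressively_measurable F Y"
  shows "progressively_measurable F (\<lambda>t \<omega>. X t \<omega> * Y t \<omega>)"
  by (rule progressively_measurableI, rule borel_measurable_times)
    (rule progressively_measurableD[OF assms(1)] progressively_measurableD[OF assms(2)]; assumption)+

lemma progressively_measurable_time:
  assumes "\<phi> \<in> borel_measurable borel"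
  shows "progressively_measurable F (\<lambda>t \<omega>. \<phi> t)"
  by (rule progressively_measurableI, rule measurable_compose[OF measurable_fst measurable_restrict_space1[OF assms]])

text \<open>Measurability of a parametrised integral, with the pair of time bound and path as
  parameter. The Bochner integral is 0 by convention where the integrand is not integrable, so
  exceptional paths are covered as well.\<close>

lemma progressively_measurable_LINT:
  assumes "progressively_measurable F X"
  shows "progressively_measurable F (\<lambda>t \<omega>. LINT s:{0..t}|lborel. X s \<omega>)"
proof (rule progressively_measurableI)
  fix t :: real assume t: "0 \<le> t"
  let ?R = "restrict_space borel {0..t} \<Otimes>\<^sub>M F t"
  \<comment> \<open>\<open>X\<close> is controlled on [0, t] only. Clamping time into that interval
    gives a function measurable over the whole line, and the indicator removes the clamped
    values.\<close>
  have clamp: "(\<lambda>s. max 0 (min t s)) \<in> borel \<rightarrow>\<^sub>M restrict_space borel {0..t}"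
    using t by (intro measurable_restrict_space2) auto
  have [measurable]: "(\<lambda>p. fst (fst p)) \<in> borel_measurable (?R \<Otimes>\<^sub>M lborel)"
    by (intro measurable_compose[OF measurable_compose[OF measurable_fst measurable_fst]]
        measurable_restrict_space1 measurable_ident_sets[OF refl])
  have X: "(\<lambda>p. X (max 0 (min t (snd p))) (snd (fst p))) \<in> borel_measurable (?R \<Otimes>\<^sub>M lborel)"
  proof -
    have "(\<lambda>p. (max 0 (min t (snd p)), snd (fst p))) \<in> ?R \<Otimes>\<^sub>M lborel \<rightarrow>\<^sub>M ?R"
      by (intro measurable_Pair measurable_compose[OF measurable_fst measurable_snd]
          measurable_compose[OF _ clamp]) auto
    from measurable_compose[OF this progressively_measurableD[OF assms t]] show ?thesis by simp
  qed
  have "(\<lambda>p. indicator {0..fst (fst p)} (snd p) * X (max 0 (min t (snd p))) (snd (fst p)))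
      = (\<lambda>p. if 0 \<le> snd p \<and> snd p \<le> fst (fst p) then X (max 0 (min t (snd p))) (snd (fst p)) else 0)"
    by (auto simp: fun_eq_iff indicator_def)
  also have "\<dots> \<in> borel_measurable (?R \<Otimes>\<^sub>M lborel)"
    using X by measurable
  finally have "(\<lambda>(p, s). indicator {0..fst p} s * X (max 0 (min t s)) (snd p)) \<in> borel_measurable (?R \<Otimes>\<^sub>M lborel)"
    by (simp add: case_prod_beta')
  then have "(\<lambda>p. \<integral>s. indicator {0..fst p} s * X (max 0 (min t s)) (snd p) \<partial>lborel) \<in> borel_measurable ?R"
    by (rule lborel.borel_measurable_lebesgue_integral)
  also have "?this \<longleftrightarrow> (\<lambda>p. LINT s:{0..fst p}|lborel. X s (snd p)) \<in> borel_measurable ?R"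
    by (intro measurable_cong)
      (auto simp: set_lebesgue_integral_def space_pair_measure space_restrict_space indicator_def
        intro!: Bochner_Integration.integral_cong)
  finally show "(\<lambda>p. LINT s:{0..fst p}|lborel. X s (snd p)) \<in> borel_measurable ?R" .
qed

text \<open>Used with the constant family at \<open>completion P\<close> as target, where
  measurability of time integrals no longer depends on when a variable becomes known.\<close>

lemma progressively_measurable_mono:
  assumes "progressively_measurable F X"
    and FG: "\<And>t. 0 \<le> t \<Longrightarrow> sets (F t) \<subseteq> sets (G t)" "\<And>t. 0 \<le> t \<Longrightarrow> space (F t) = space (G t)"
  shows "progressively_measurable G X"
proof (rule progressively_measurableI)
  fix t :: real assume t: "0 \<le> t"
  have "(\<lambda>\<omega>. \<omega>) \<in> G t \<rightarrow>\<^sub>M F t"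
  proof (rule measurableI)
    fix A assume A: "A \<in> sets (F t)"
    then have "(\<lambda>\<omega>. \<omega>) -` A \<inter> space (G t) = A"
      using sets.sets_into_space[OF A] FG(2)[OF t] by auto
    then show "(\<lambda>\<omega>. \<omega>) -` A \<inter> space (G t) \<in> sets (G t)"
      using A FG(1)[OF t] by auto
  qed (use FG(2)[OF t] in simp)
  then have "(\<lambda>p. (fst p, snd p)) \<in> restrict_space borel {0..t} \<Otimes>\<^sub>M G t \<rightarrow>\<^sub>M restrict_space borel {0..t} \<Otimes>\<^sub>M F t"
    by (intro measurable_Pair measurable_fst measurable_compose[OF measurable_snd])
  from measurable_compose[OF this progressively_measurableD[OF assms(1) t]]
  show "(\<lambda>p. X (fst p) (snd p)) \<in> borel_measurable (restrict_space borel {0..t} \<Otimes>\<^sub>M G t)"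
    by simp
qed

text \<open>Rounding time down to multiples of 1/(n + 1) leaves countably many times, for which
  joint measurability can be checked piece by piece; continuity of the paths carries it to the
  limit. Rounding down keeps the times within [0, t].\<close>

lemma progressively_measurable_continuous:
  assumes X: "\<And>s t. 0 \<le> s \<Longrightarrow> s \<le> t \<Longrightarrow> X s \<in> borel_measurable (F t)"
    and cont: "\<And>t \<omega>. 0 \<le> t \<Longrightarrow> \<omega> \<in> space (F t) \<Longrightarrow> continuous_on {0..} (\<lambda>s. X s \<omega>)"
  shows "progressively_measurable F X"
proof (rule progressively_measurableI)
  fix t :: real assume t: "0 \<le> t"
  let ?R = "restrict_space borel {0..t} \<Otimes>\<^sub>M F t"
  define r where "r n s = real (nat \<lfloor>s * real (Suc n)\<rfloor>) / real (Suc n)" for n s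
  have r: "0 \<le> r n s" "r n s \<le> s" "s - inverse (real (Suc n)) \<le> r n s" if "0 \<le> s" for n s
  proof -
    have e: "real (nat \<lfloor>s * real (Suc n)\<rfloor>) = of_int \<lfloor>s * real (Suc n)\<rfloor>"
      using that by (simp add: of_nat_nat)
    show "0 \<le> r n s" by (simp add: r_def)
    show "r n s \<le> s"
      unfolding r_def e by (simp add: divide_le_eq del: of_nat_Suc)
    have "s * real (Suc n) - 1 \<le> of_int \<lfloor>s * real (Suc n)\<rfloor>"
      by linarith
    then have "(s * real (Suc n) - 1) / real (Suc n) \<le> r n s"
      unfolding r_def e by (intro divide_right_mono) auto
    then show "s - inverse (real (Suc n)) \<le> r n s"
      by (simp add: diff_divide_distrib inverse_eq_divide del: of_nat_Suc)
  qed
  show "(\<lambda>p. X (fst p) (snd p)) \<in> borel_measurable ?R"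
  proof (rule borel_measurable_LIMSEQ_real)
    fix p assume p: "p \<in> space ?R"
    then have s: "0 \<le> fst p" "snd p \<in> space (F t)"
      by (auto simp: space_pair_measure space_restrict_space)
    have lim: "(\<lambda>n. r n (fst p)) \<longlonglongrightarrow> fst p"
    proof (rule tendsto_sandwich)
      show "(\<lambda>n. fst p - inverse (real (Suc n))) \<longlonglongrightarrow> fst p"
        using tendsto_diff[OF tendsto_const LIMSEQ_inverse_real_of_nat, of "fst p"] by simp
    qed (use r[OF s(1)] in auto)
    show "(\<lambda>n. X (r n (fst p)) (snd p)) \<longlonglongrightarrow> X (fst p) (snd p)"
      using continuous_on_tendsto_compose[OF cont[OF t s(2)] lim] s(1) r[OF s(1)] by simp
  next
    fix n
    have "(\<lambda>p. nat \<lfloor>fst p * real (Suc n)\<rfloor>) \<in> ?R \<rightarrow>\<^sub>M count_space UNIV"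
    proof -
      have "(\<lambda>s. nat \<lfloor>s * real (Suc n)\<rfloor>) \<in> borel \<rightarrow>\<^sub>M count_space UNIV"
        by measurable
      then show ?thesis
        by (rule measurable_compose[OF measurable_fst measurable_restrict_space1])
    qed
    \<comment> \<open>The minimum with \<open>t\<close> makes each of the countably many pieces
      measurable with respect to \<open>F t\<close>; on the domain it changes nothing.\<close>
    moreover have "(\<lambda>p. X (min t (real m / real (Suc n))) (snd p)) \<in> borel_measurable ?R" for m
      by (rule measurable_compose[OF measurable_snd X]) (use t in auto)
    ultimately have "(\<lambda>p. X (min t (real (nat \<lfloor>fst p * real (Suc n)\<rfloor>) / real (Suc n))) (snd p)) \<in> borel_measurable ?R"
      by (rule measurable_compose_countable[rotated])
    also have "?this \<longleftrightarrow> (\<lambda>p. X (r n (fst p)) (snd p)) \<in> borel_measurable ?R"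
    proof (rule measurable_cong)
      fix p assume "p \<in> space ?R"
      then have "0 \<le> fst p" "fst p \<le> t"
        by (auto simp: space_pair_measure space_restrict_space)
      with r(2)[of "fst p" n] have "min t (r n (fst p)) = r n (fst p)"
        by simp
      then show "X (min t (real (nat \<lfloor>fst p * real (Suc n)\<rfloor>) / real (Suc n))) (snd p) = X (r n (fst p)) (snd p)"
        by (simp add: r_def)
    qed
    finally show "(\<lambda>p. X (r n (fst p)) (snd p)) \<in> borel_measurable ?R" .
  qed
qed

section \<open>Brownian increments and the augmented filtration\<close>

text \<open>
  At a Gaussian increment of variance \<open>v\<close>, \<open>exp_remainder \<sigma> v\<close> is centred with variance \<open>O(v\<^sup>2)\<close>: the
  term \<open>- \<sigma>\<^sup>2 / 2 * v\<close> in the exponent makes Ito's correction exact instead of asymptotic.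
\<close>

definition exp_remainder :: "real \<Rightarrow> real \<Rightarrow> real \<Rightarrow> real" where
  "exp_remainder \<sigma> v x = exp (- \<sigma> * x - \<sigma>\<^sup>2 / 2 * v) - 1 + \<sigma> * x"

lemma borel_measurable_exp_remainder [measurable]: "exp_remainder \<sigma> v \<in> borel_measurable borel"
  unfolding exp_remainder_def[abs_def] by measurable

section \<open>Gaussian moments of the remainder\<close>

text \<open>Completing the square: a normalised exponential tilt shifts the centre of the Gaussian
  and keeps its variance, which is the one-dimensional Cameron-Martin formula.\<close>

lemma normal_density_times_exp:
  assumes "0 < v"
  shows "normal_density 0 (sqrt v) x * exp (- k * x - k\<^sup>2 / 2 * v) = normal_density (- k * v) (sqrt v) x"
proof -
  have "- (x - 0)\<^sup>2 / (2 * (sqrt v)\<^sup>2) + (- k * x - k\<^sup>2 / 2 * v) = - (x - - k * v)\<^sup>2 / (2 * (sqrt v)\<^sup>2)"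
    using assms by (simp add: field_simps power2_eq_square)
  then show ?thesis
    by (simp add: normal_density_def exp_add[symmetric] mult.assoc)
qed

lemma has_bochner_integral_normal_density:
  "0 < s \<Longrightarrow> has_bochner_integral lborel (normal_density m s) 1"
  by (simp add: has_bochner_integral_iff)

text \<open>The exponential turns the density into a shifted one, again of mass 1, which cancels the
  term -1; the linear term has mean 0.\<close>

lemma has_bochner_integral_normal_exp_remainder:
  assumes v: "0 < v"
  shows "has_bochner_integral lborel (\<lambda>x. normal_density 0 (sqrt v) x * exp_remainder \<sigma> v x) 0"
proof -
  have s: "0 < sqrt v" using v by simp
  have "has_bochner_integral lborel (\<lambda>x. normal_density (- \<sigma> * v) (sqrt v) x - normal_density 0 (sqrt v) x
      + \<sigma> * (normal_density 0 (sqrt v) x * x)) (1 - 1 + \<sigma> * 0)"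
    by (intro has_bochner_integral_add has_bochner_integral_diff has_bochner_integral_mult_right
        has_bochner_integral_normal_density normal_moment_nz_1 s)
  moreover have "normal_density (- \<sigma> * v) (sqrt v) x - normal_density 0 (sqrt v) x
      + \<sigma> * (normal_density 0 (sqrt v) x * x) = normal_density 0 (sqrt v) x * exp_remainder \<sigma> v x" for x
    unfolding normal_density_times_exp[OF v, symmetric] exp_remainder_def by (simp add: algebra_simps)
  ultimately show ?thesis by simp
qed

text \<open>With u = \<open>\<sigma>\<^sup>2 * v\<close> the value is exp u - 1 - u, hence of second
  order in v, whereas the increment itself has variance v.\<close>

lemma has_bochner_integral_normal_exp_remainder_sq:
  assumes v: "0 < v"
  shows "has_bochner_integral lborel (\<lambda>x. normal_density 0 (sqrt v) x * (exp_remainder \<sigma> v x)\<^sup>2)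
           (exp (\<sigma>\<^sup>2 * v) - 1 - \<sigma>\<^sup>2 * v)"
proof -
  have s: "0 < sqrt v" using v by simp
  have second: "has_bochner_integral lborel (\<lambda>x. normal_density 0 (sqrt v) x * x\<^sup>2) v"
    using normal_moment_even[OF s, of 0 1] v by (simp add: fact_numeral)
  have "has_bochner_integral lborel (\<lambda>x. exp (\<sigma>\<^sup>2 * v) * normal_density (- (2 * \<sigma>) * v) (sqrt v) x
      + normal_density 0 (sqrt v) x + \<sigma>\<^sup>2 * (normal_density 0 (sqrt v) x * x\<^sup>2)
      - 2 * normal_density (- \<sigma> * v) (sqrt v) x
      + (2 * \<sigma>) * (normal_density (- \<sigma> * v) (sqrt v) x * x)
      - (2 * \<sigma>) * (normal_density 0 (sqrt v) x * x))
    (exp (\<sigma>\<^sup>2 * v) * 1 + 1 + \<sigma>\<^sup>2 * v - 2 * 1 + (2 * \<sigma>) * (- \<sigma> * v) - (2 * \<sigma>) * 0)"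
    by (intro has_bochner_integral_add has_bochner_integral_diff has_bochner_integral_mult_right
        has_bochner_integral_normal_density normal_moment_nz_1 s second)
  moreover have "exp (\<sigma>\<^sup>2 * v) * 1 + 1 + \<sigma>\<^sup>2 * v - 2 * 1 + (2 * \<sigma>) * (- \<sigma> * v) - (2 * \<sigma>) * 0
      = exp (\<sigma>\<^sup>2 * v) - 1 - \<sigma>\<^sup>2 * v"
    by (simp add: algebra_simps power2_eq_square)
  moreover have "exp (\<sigma>\<^sup>2 * v) * normal_density (- (2 * \<sigma>) * v) (sqrt v) x
      + normal_density 0 (sqrt v) x + \<sigma>\<^sup>2 * (normal_density 0 (sqrt v) x * x\<^sup>2)
      - 2 * normal_density (- \<sigma> * v) (sqrt v) x
      + (2 * \<sigma>) * (normal_density (- \<sigma> * v) (sqrt v) x * x)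
      - (2 * \<sigma>) * (normal_density 0 (sqrt v) x * x)
    = normal_density 0 (sqrt v) x * (exp_remainder \<sigma> v x)\<^sup>2" for x
  proof -
    define E where "E = exp (- \<sigma> * x - \<sigma>\<^sup>2 / 2 * v)"
    \<comment> \<open>Squaring \<open>E\<close> doubles its normalisation, while a tilt by twice
      \<sigma> needs four times as much; the factor \<open>exp (\<sigma>\<^sup>2 * v)\<close> makes
      up the difference.\<close>
    have "exp (\<sigma>\<^sup>2 * v) * exp (- (2 * \<sigma>) * x - (2 * \<sigma>)\<^sup>2 / 2 * v) = E\<^sup>2"
      unfolding E_def power2_eq_square[of "exp _"] exp_add[symmetric]
      by (rule arg_cong[of _ _ exp]) (simp add: power2_eq_square field_simps)
    moreover have "normal_density (- (2 * \<sigma>) * v) (sqrt v) x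
        = normal_density 0 (sqrt v) x * exp (- (2 * \<sigma>) * x - (2 * \<sigma>)\<^sup>2 / 2 * v)"
      by (rule normal_density_times_exp[OF v, symmetric])
    ultimately have e2: "exp (\<sigma>\<^sup>2 * v) * normal_density (- (2 * \<sigma>) * v) (sqrt v) x
        = normal_density 0 (sqrt v) x * E\<^sup>2"
      by (metis mult.left_commute)
    have e1: "normal_density (- \<sigma> * v) (sqrt v) x = normal_density 0 (sqrt v) x * E"
      unfolding E_def by (rule normal_density_times_exp[OF v, symmetric])
    have R: "exp_remainder \<sigma> v x = E - 1 + \<sigma> * x"
      unfolding exp_remainder_def E_def ..
    show ?thesis
      unfolding e1 e2 R by (simp add: algebra_simps power2_eq_square)
  qed
  ultimately show ?thesis by (simp only:)
qed

section \<open>Wiener space, augmentation and independence of increments\<close>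

locale wiener_space =
  fixes P :: "(real \<Rightarrow> real) measure"
  assumes wiener: "wiener_measure P"
begin

sublocale P: prob_space P
  using wiener by (simp add: wiener_measure_def)

text \<open>The augmented sigma-algebras contain all null sets of the completion and need not lie in
  \<open>sets P\<close>, so expectations are taken under the completion.\<close>

sublocale Q: prob_space "completion P"
  by (rule P.prob_space_completion)

lemma space_P [simp]: "space P = path_space"
  using wiener by (simp add: wiener_measure_def)

lemma W_measurable:
  assumes "0 \<le> t"
  shows "W t \<in> borel_measurable P"
proof -
  have "W t \<in> borel_measurable path_algebra"
    unfolding path_algebra_def W_def[abs_def] using assms
    by (intro measurable_restrict_space1 measurable_component_singleton) simp
  moreover have "sets P = sets path_algebra"
    using wiener by (simp add: wiener_measure_def)
  ultimately show ?thesis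
    by (simp cong: measurable_cong_sets)
qed

lemma W_continuous: "\<omega> \<in> path_space \<Longrightarrow> continuous_on {0..} (\<lambda>t. W t \<omega>)"
  by (simp add: path_space_def W_def)

lemma space_natural [simp]: "space (natural_filtration P W t) = path_space"
  by (simp add: natural_filtration_def space_measure_of_conv)

lemma sets_natural:
  "sets (natural_filtration P W t) =
     sigma_sets path_space {W s -` B \<inter> path_space | s B. 0 \<le> s \<and> s \<le> t \<and> B \<in> sets borel}"
  unfolding natural_filtration_def space_P by (rule sets_measure_of) auto

lemma sets_natural_subset: "sets (natural_filtration P W t) \<subseteq> sets P"
  unfolding sets_natural
proof (rule sets.sigma_sets_subset[of _ P, unfolded space_P])
  show "{W s -` B \<inter> path_space | s B. 0 \<le> s \<and> s \<le> t \<and> B \<in> sets borel} \<subseteq> sets P"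
    using measurable_sets[OF W_measurable] by auto
qed

lemma space_F [simp]: "space (\<F> P t) = path_space"
  by (simp add: \<F>_def augmented_filtration_def space_measure_of_conv)

lemma sets_F:
  "sets (\<F> P t) = sigma_sets path_space (sets (natural_filtration P W t) \<union> null_sets (completion P))"
proof -
  have "sets (natural_filtration P W t) \<union> null_sets (completion P) \<subseteq> Pow path_space"
    using sets.sets_into_space[of _ "natural_filtration P W t"] sets.sets_into_space[of _ "completion P"]
    by auto
  then show ?thesis
    unfolding \<F>_def augmented_filtration_def by (simp add: sets_measure_of)
qed

lemma sets_F_subset: "sets (\<F> P t) \<subseteq> sets (completion P)"
  unfolding sets_F using sets_natural_subset[of t]
  by (intro sets.sigma_sets_subset[of _ "completion P", unfolded space_completion space_P])
    (auto intro: sets_completionI_sets)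

lemma measurable_F_completion:
  assumes "f \<in> borel_measurable (\<F> P t)"
  shows "f \<in> borel_measurable (completion P)"
  by (rule subsetD[OF measurable_mono[OF order_refl refl sets_F_subset] assms]) simp

lemma sets_F_mono:
  assumes "s \<le> t"
  shows "sets (\<F> P s) \<subseteq> sets (\<F> P t)"
proof -
  have "sets (natural_filtration P W s) \<subseteq> sets (natural_filtration P W t)"
    unfolding sets_natural
  proof (rule sigma_sets_mono', safe)
    fix r :: real and B :: "real set" assume "0 \<le> r" "r \<le> s" "B \<in> sets borel"
    with assms show "\<exists>s B'. W r -` B \<inter> path_space = W s -` B' \<inter> path_space \<and> 0 \<le> s \<and> s \<le> t \<and> B' \<in> sets borel"
      by (intro exI[of _ r] exI[of _ B]) auto
  qed
  then show ?thesis
    unfolding sets_F by (rule sigma_sets_mono'[OF Un_mono]) (rule order_refl)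
qed

lemma measurable_F_mono:
  assumes "f \<in> borel_measurable (\<F> P s)" "s \<le> t"
  shows "f \<in> borel_measurable (\<F> P t)"
  by (rule subsetD[OF measurable_mono[OF order_refl refl sets_F_mono[OF assms(2)]] assms(1)]) simp

lemma W_measurable_F:
  assumes "0 \<le> s" "s \<le> t"
  shows "W s \<in> borel_measurable (\<F> P t)"
proof (rule measurableI)
  fix B :: "real set" assume "B \<in> sets borel"
  with assms have "W s -` B \<inter> path_space \<in> sets (natural_filtration P W t)"
    unfolding sets_natural by (intro sigma_sets.Basic) auto
  then show "W s -` B \<inter> space (\<F> P t) \<in> sets (\<F> P t)"
    unfolding sets_F by (auto intro: sigma_sets.Basic)
qed simp

text \<open>The sets that agree almost everywhere with a natural one form a sigma-algebra containing
  both kinds of generators.\<close>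

lemma F_almost_natural:
  assumes "A \<in> sets (\<F> P t)"
  shows "\<exists>B\<in>sets (natural_filtration P W t). AE \<omega> in completion P. \<omega> \<in> A \<longleftrightarrow> \<omega> \<in> B"
  using assms unfolding sets_F
proof induction
  case (Basic A)
  then show ?case
  proof
    assume "A \<in> null_sets (completion P)"
    from AE_not_in[OF this] show ?case by (intro bexI[of _ "{}"]) auto
  qed auto
next
  case (Compl A)
  then obtain B where B: "B \<in> sets (natural_filtration P W t)" "AE \<omega> in completion P. \<omega> \<in> A \<longleftrightarrow> \<omega> \<in> B"
    by blast
  have "AE \<omega> in completion P. \<omega> \<in> path_space - A \<longleftrightarrow> \<omega> \<in> path_space - B"
    using B(2) by eventually_elim auto
  then show ?case
    using sets.compl_sets[OF B(1)] by (intro bexI[of _ "path_space - B"]) auto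
next
  case (Union A)
  then obtain B where B: "\<And>i. B i \<in> sets (natural_filtration P W t)"
      "\<And>i. AE \<omega> in completion P. \<omega> \<in> A i \<longleftrightarrow> \<omega> \<in> B i"
    by metis
  have "AE \<omega> in completion P. \<forall>i. \<omega> \<in> A i \<longleftrightarrow> \<omega> \<in> B i"
    using B(2) by (simp add: AE_all_countable)
  then have "AE \<omega> in completion P. \<omega> \<in> (\<Union>i. A i) \<longleftrightarrow> \<omega> \<in> (\<Union>i. B i)"
    by eventually_elim auto
  then show ?case
    using B(1) by (intro bexI[of _ "\<Union>i. B i"]) auto
qed auto

text \<open>Replacing an augmented event by an almost equal natural one alters no probability, so
  the independence postulated in \<open>wiener_measure\<close> persists.\<close>

lemma indep_set_increment:
  assumes st: "0 \<le> s" "s < t"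
  shows "Q.indep_set (sets (\<F> P s)) {(\<lambda>\<omega>. W t \<omega> - W s \<omega>) -` B \<inter> path_space | B. B \<in> sets borel}"
  unfolding Q.indep_sets2_eq
proof (intro conjI ballI)
  have D: "(\<lambda>\<omega>. W t \<omega> - W s \<omega>) \<in> borel_measurable P"
    using W_measurable st by (intro borel_measurable_diff) auto
  have ev: "{(\<lambda>\<omega>. W t \<omega> - W s \<omega>) -` B \<inter> path_space | B. B \<in> sets borel} \<subseteq> sets P"
    using measurable_sets[OF D] by auto
  then show "{(\<lambda>\<omega>. W t \<omega> - W s \<omega>) -` B \<inter> path_space | B. B \<in> sets borel} \<subseteq> sets (completion P)"
    by auto
  show "sets (\<F> P s) \<subseteq> sets (completion P)" by (rule sets_F_subset)
  fix A D assume A: "A \<in> sets (\<F> P s)"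
    and D: "D \<in> {(\<lambda>\<omega>. W t \<omega> - W s \<omega>) -` B \<inter> path_space | B. B \<in> sets borel}"
  have DP: "D \<in> sets P" using D ev by blast
  obtain B where B: "B \<in> sets (natural_filtration P W s)" and AB: "AE \<omega> in completion P. \<omega> \<in> A \<longleftrightarrow> \<omega> \<in> B"
    using F_almost_natural[OF A] by blast
  have BP: "B \<in> sets P" using B sets_natural_subset by blast
  have AQ: "A \<in> sets (completion P)" using A sets_F_subset by blast
  have ind: "P.indep_set (sets (natural_filtration P W s))
      {(\<lambda>\<omega>. W t \<omega> - W s \<omega>) -` B \<inter> path_space | B. B \<in> sets borel}"
    using wiener st unfolding wiener_measure_def by simp
  have "Q.prob (A \<inter> D) = Q.prob (B \<inter> D)"
    using AB AQ BP DP by (intro measure_eq_AE) (auto elim!: eventually_mono)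
  also have "\<dots> = P.prob B * P.prob D"
    using P.indep_setD[OF ind B D] BP DP by simp
  also have "P.prob B = Q.prob A"
    using measure_completion[OF BP] measure_eq_AE[OF AB AQ] BP by auto
  finally show "Q.prob (A \<inter> D) = Q.prob A * Q.prob D"
    using DP by simp
qed

text \<open>Serves two purposes: it makes cross terms with a centred function of the increment
  vanish, and it factorises the expectations of squares.\<close>

lemma expectation_increment:
  fixes U :: "(real \<Rightarrow> real) \<Rightarrow> real" and \<phi> :: "real \<Rightarrow> real"
  assumes st: "0 \<le> s" "s < t" and U: "U \<in> borel_measurable (\<F> P s)" "integrable (completion P) U"
    and \<phi>: "\<phi> \<in> borel_measurable borel" "integrable (completion P) (\<lambda>\<omega>. \<phi> (W t \<omega> - W s \<omega>))"
  shows "integrable (completion P) (\<lambda>\<omega>. U \<omega> * \<phi> (W t \<omega> - W s \<omega>))"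
    and "Q.expectation (\<lambda>\<omega>. U \<omega> * \<phi> (W t \<omega> - W s \<omega>)) =
           Q.expectation U * Q.expectation (\<lambda>\<omega>. \<phi> (W t \<omega> - W s \<omega>))"
proof -
  let ?D = "\<lambda>\<omega>. W t \<omega> - W s \<omega>"
  have "Q.indep_var borel U borel (\<lambda>\<omega>. \<phi> (?D \<omega>))"
    unfolding Q.indep_var_eq
  proof (intro conjI)
    show "U \<in> borel_measurable (completion P)" by (rule measurable_F_completion[OF U(1)])
    show "(\<lambda>\<omega>. \<phi> (?D \<omega>)) \<in> borel_measurable (completion P)" using \<phi>(2) by simp
    show "Q.indep_set (sigma_sets (space (completion P)) {U -` A \<inter> space (completion P) | A. A \<in> sets borel})
        (sigma_sets (space (completion P)) {(\<lambda>\<omega>. \<phi> (?D \<omega>)) -` A \<inter> space (completion P) | A. A \<in> sets borel})"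
      (is "Q.indep_set ?A ?B")
    proof -
      have A: "?A \<subseteq> sets (\<F> P s)"
        using sets.sigma_sets_subset[of "{U -` A \<inter> path_space | A. A \<in> sets borel}" "\<F> P s"]
          measurable_sets[OF U(1)] by auto
      \<comment> \<open>The preimages under the increment already form a sigma-algebra, so whatever
        \<open>\<phi>\<close> of the increment generates stays inside the independent
        family.\<close>
      have "?B \<subseteq> sets (vimage_algebra path_space ?D borel)"
      proof -
        have "(\<lambda>\<omega>. \<phi> (?D \<omega>)) -` A \<inter> path_space \<in> sets (vimage_algebra path_space ?D borel)"
          if "A \<in> sets borel" for A
        proof -
          have "(\<lambda>\<omega>. \<phi> (?D \<omega>)) -` A \<inter> path_space = ?D -` (\<phi> -` A) \<inter> path_space" by auto
          moreover have "\<phi> -` A \<in> sets borel"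
            using measurable_sets[OF \<phi>(1) that] by simp
          ultimately show ?thesis
            by (metis in_vimage_algebra)
        qed
        then show ?thesis
          using sets.sigma_sets_subset[of "{(\<lambda>\<omega>. \<phi> (?D \<omega>)) -` A \<inter> path_space | A. A \<in> sets borel}"
              "vimage_algebra path_space ?D borel"]
          unfolding space_completion space_P space_vimage_algebra by blast
      qed
      then have B: "?B \<subseteq> {?D -` B \<inter> path_space | B. B \<in> sets borel}"
        by (simp add: sets_vimage_algebra2)
      note ind = indep_set_increment[OF st]
      show ?thesis
        unfolding Q.indep_sets2_eq
      proof (intro conjI ballI)
        show "?A \<subseteq> Q.events" by (rule subset_trans[OF A sets_F_subset])
        show "?B \<subseteq> Q.events" by (rule subset_trans[OF B Q.indep_setD_ev2[OF ind]])
        show "Q.prob (a \<inter> b) = Q.prob a * Q.prob b" if "a \<in> ?A" "b \<in> ?B" for a b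
          by (rule Q.indep_setD[OF ind subsetD[OF A that(1)] subsetD[OF B that(2)]])
      qed
    qed
  qed
  from Q.indep_var_integrable[OF this U(2) \<phi>(2)] Q.indep_var_lebesgue_integral[OF this U(2) \<phi>(2)]
  show "integrable (completion P) (\<lambda>\<omega>. U \<omega> * \<phi> (?D \<omega>))"
    and "Q.expectation (\<lambda>\<omega>. U \<omega> * \<phi> (?D \<omega>)) = Q.expectation U * Q.expectation (\<lambda>\<omega>. \<phi> (?D \<omega>))"
    by auto
qed

lemma has_bochner_integral_increment:
  fixes \<phi> :: "real \<Rightarrow> real"
  assumes st: "0 \<le> s" "s < t" and \<phi>: "\<phi> \<in> borel_measurable borel"
    and int: "has_bochner_integral lborel (\<lambda>x. normal_density 0 (sqrt (t - s)) x * \<phi> x) y"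
  shows "has_bochner_integral (completion P) (\<lambda>\<omega>. \<phi> (W t \<omega> - W s \<omega>)) y"
proof -
  have D: "distributed P lborel (\<lambda>\<omega>. W t \<omega> - W s \<omega>) (normal_density 0 (sqrt (t - s)))"
    using wiener st unfolding wiener_measure_def by simp
  have "(\<lambda>\<omega>. W t \<omega> - W s \<omega>) \<in> borel_measurable P"
    using W_measurable st by (intro borel_measurable_diff) auto
  then have m: "(\<lambda>\<omega>. \<phi> (W t \<omega> - W s \<omega>)) \<in> borel_measurable P"
    using \<phi> by (rule measurable_compose)
  have "integrable P (\<lambda>\<omega>. \<phi> (W t \<omega> - W s \<omega>))"
    using distributed_integrable[OF D, of \<phi>] \<phi> int by (auto simp: has_bochner_integral_iff)
  moreover have "P.expectation (\<lambda>\<omega>. \<phi> (W t \<omega> - W s \<omega>)) = y"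
    using distributed_integral[OF D, of \<phi>] \<phi> int by (auto simp: has_bochner_integral_iff)
  ultimately show ?thesis
    using m by (simp add: has_bochner_integral_iff integrable_completion integral_completion)
qed

section \<open>Orthogonality of the remainders\<close>

text \<open>In the expanded square the cross term is a mean times the mean 0 of the remainder, so
  second moments add up as for orthogonal vectors.\<close>

lemma expectation_sq_add_remainder:
  fixes \<sigma> :: real
  assumes st: "0 \<le> s" "s \<le> t"
    and S: "S \<in> borel_measurable (\<F> P s)" "integrable (completion P) (\<lambda>\<omega>. (S \<omega>)\<^sup>2)"
    and \<zeta>: "\<zeta> \<in> borel_measurable (\<F> P s)" "\<And>\<omega>. \<omega> \<in> path_space \<Longrightarrow> \<bar>\<zeta> \<omega>\<bar> \<le> K"
  defines "N \<equiv> \<lambda>\<omega>. S \<omega> + \<zeta> \<omega> * exp_remainder \<sigma> (t - s) (W t \<omega> - W s \<omega>)"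
  shows "integrable (completion P) (\<lambda>\<omega>. (N \<omega>)\<^sup>2)"
    and "Q.expectation (\<lambda>\<omega>. (N \<omega>)\<^sup>2) \<le>
           Q.expectation (\<lambda>\<omega>. (S \<omega>)\<^sup>2) + K\<^sup>2 * (exp (\<sigma>\<^sup>2 * (t - s)) - 1 - \<sigma>\<^sup>2 * (t - s))"
proof -
  have "integrable (completion P) (\<lambda>\<omega>. (N \<omega>)\<^sup>2) \<and> Q.expectation (\<lambda>\<omega>. (N \<omega>)\<^sup>2) \<le>
           Q.expectation (\<lambda>\<omega>. (S \<omega>)\<^sup>2) + K\<^sup>2 * (exp (\<sigma>\<^sup>2 * (t - s)) - 1 - \<sigma>\<^sup>2 * (t - s))"
  \<comment> \<open>A degenerate increment has no density; its remainder is exactly 0.\<close>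
  proof (cases "s = t")
    case True
    then show ?thesis using S(2) by (simp add: N_def exp_remainder_def)
  next
    case False
    with st have st': "s < t" by simp
    let ?D = "\<lambda>\<omega>. W t \<omega> - W s \<omega>" and ?R = "exp_remainder \<sigma> (t - s)"
    let ?r = "exp (\<sigma>\<^sup>2 * (t - s)) - 1 - \<sigma>\<^sup>2 * (t - s)"
    have R: "has_bochner_integral (completion P) (\<lambda>\<omega>. ?R (?D \<omega>)) 0"
      using st' by (intro has_bochner_integral_increment st(1) has_bochner_integral_normal_exp_remainder) auto
    have R2: "has_bochner_integral (completion P) (\<lambda>\<omega>. (?R (?D \<omega>))\<^sup>2) ?r"
      using st' by (intro has_bochner_integral_increment[where \<phi>="\<lambda>x. (?R x)\<^sup>2"] st(1)
          has_bochner_integral_normal_exp_remainder_sq) auto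
    have SQ: "S \<in> borel_measurable (completion P)" and \<zeta>Q: "\<zeta> \<in> borel_measurable (completion P)"
      using S(1) \<zeta>(1) by (auto intro: measurable_F_completion)
    have iS: "integrable (completion P) S"
      by (rule Q.square_integrable_imp_integrable[OF SQ S(2)])
    \<comment> \<open>\<open>\<zeta>\<close> is bounded, so the product inherits integrability from
      \<open>S\<close>.\<close>
    have iS\<zeta>: "integrable (completion P) (\<lambda>\<omega>. S \<omega> * \<zeta> \<omega>)"
    proof (rule Bochner_Integration.integrable_bound)
      show "integrable (completion P) (\<lambda>\<omega>. K * S \<omega>)" using iS by simp
      show "(\<lambda>\<omega>. S \<omega> * \<zeta> \<omega>) \<in> borel_measurable (completion P)" using SQ \<zeta>Q by simp
      show "AE \<omega> in completion P. norm (S \<omega> * \<zeta> \<omega>) \<le> norm (K * S \<omega>)"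
      proof (rule AE_I2)
        fix \<omega> assume "\<omega> \<in> space (completion P)"
        then have "\<bar>\<zeta> \<omega>\<bar> \<le> \<bar>K\<bar>" using \<zeta>(2)[of \<omega>] by simp
        then have "\<bar>S \<omega>\<bar> * \<bar>\<zeta> \<omega>\<bar> \<le> \<bar>K\<bar> * \<bar>S \<omega>\<bar>"
          by (metis abs_ge_zero mult.commute mult_left_mono)
        then show "norm (S \<omega> * \<zeta> \<omega>) \<le> norm (K * S \<omega>)"
          by (simp add: abs_mult)
      qed
    qed
    have \<zeta>2: "(\<zeta> \<omega>)\<^sup>2 \<le> K\<^sup>2" if "\<omega> \<in> path_space" for \<omega>
      using power_mono[OF \<zeta>(2)[OF that] abs_ge_zero, of 2] by simp
    have i\<zeta>2: "integrable (completion P) (\<lambda>\<omega>. (\<zeta> \<omega>)\<^sup>2)"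
      by (rule Q.integrable_const_bound[of _ "K\<^sup>2"]) (use \<zeta>2 \<zeta>Q in auto)
    have e\<zeta>2: "Q.expectation (\<lambda>\<omega>. (\<zeta> \<omega>)\<^sup>2) \<le> K\<^sup>2"
      by (rule Q.integral_le_const[OF i\<zeta>2]) (use \<zeta>2 in auto)
    have mS\<zeta>: "(\<lambda>\<omega>. S \<omega> * \<zeta> \<omega>) \<in> borel_measurable (\<F> P s)" and m\<zeta>2: "(\<lambda>\<omega>. (\<zeta> \<omega>)\<^sup>2) \<in> borel_measurable (\<F> P s)"
      by (intro borel_measurable_times borel_measurable_power S(1) \<zeta>(1))+
    have c1: "integrable (completion P) (\<lambda>\<omega>. (S \<omega> * \<zeta> \<omega>) * ?R (?D \<omega>))"
        "Q.expectation (\<lambda>\<omega>. (S \<omega> * \<zeta> \<omega>) * ?R (?D \<omega>)) = 0"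
      using expectation_increment[OF st(1) st' mS\<zeta> iS\<zeta>, of ?R] R by (auto simp: has_bochner_integral_iff)
    have c2: "integrable (completion P) (\<lambda>\<omega>. (\<zeta> \<omega>)\<^sup>2 * (?R (?D \<omega>))\<^sup>2)"
        "Q.expectation (\<lambda>\<omega>. (\<zeta> \<omega>)\<^sup>2 * (?R (?D \<omega>))\<^sup>2) = Q.expectation (\<lambda>\<omega>. (\<zeta> \<omega>)\<^sup>2) * ?r"
      using expectation_increment[OF st(1) st' m\<zeta>2 i\<zeta>2, of "\<lambda>x. (?R x)\<^sup>2"] R2
      by (auto simp: has_bochner_integral_iff)
    have expand: "(N \<omega>)\<^sup>2 = (S \<omega>)\<^sup>2 + 2 * ((S \<omega> * \<zeta> \<omega>) * ?R (?D \<omega>)) + (\<zeta> \<omega>)\<^sup>2 * (?R (?D \<omega>))\<^sup>2" for \<omega>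
      by (simp add: N_def power2_eq_square algebra_simps)
    have "0 \<le> ?r"
      using exp_ge_add_one_self[of "\<sigma>\<^sup>2 * (t - s)"] by linarith
    then have "Q.expectation (\<lambda>\<omega>. (\<zeta> \<omega>)\<^sup>2) * ?r \<le> K\<^sup>2 * ?r"
      using e\<zeta>2 by (rule mult_right_mono[rotated])
    then show ?thesis
      unfolding expand using S(2) c1 c2 by simp
  qed
  then show "integrable (completion P) (\<lambda>\<omega>. (N \<omega>)\<^sup>2)"
    and "Q.expectation (\<lambda>\<omega>. (N \<omega>)\<^sup>2) \<le>
           Q.expectation (\<lambda>\<omega>. (S \<omega>)\<^sup>2) + K\<^sup>2 * (exp (\<sigma>\<^sup>2 * (t - s)) - 1 - \<sigma>\<^sup>2 * (t - s))"
    by auto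
qed

text \<open>The partial sums are a martingale transform. All three conjuncts go through the
  induction, since appending a term requires the previous sum to be known at the current time and
  square integrable.\<close>

lemma expectation_sq_sum_remainder:
  fixes \<sigma> :: real
  assumes p: "0 \<le> p 0" "\<And>i. p i \<le> p (Suc i)"
    and \<zeta>: "\<And>i. \<zeta> i \<in> borel_measurable (\<F> P (p i))" "\<And>i \<omega>. \<omega> \<in> path_space \<Longrightarrow> \<bar>\<zeta> i \<omega>\<bar> \<le> K"
  defines "S \<equiv> \<lambda>k \<omega>. \<Sum>i<k. \<zeta> i \<omega> * exp_remainder \<sigma> (p (Suc i) - p i) (W (p (Suc i)) \<omega> - W (p i) \<omega>)"
  shows "S k \<in> borel_measurable (\<F> P (p k)) \<and> integrable (completion P) (\<lambda>\<omega>. (S k \<omega>)\<^sup>2) \<and>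
    Q.expectation (\<lambda>\<omega>. (S k \<omega>)\<^sup>2) \<le>
      (\<Sum>i<k. K\<^sup>2 * (exp (\<sigma>\<^sup>2 * (p (Suc i) - p i)) - 1 - \<sigma>\<^sup>2 * (p (Suc i) - p i)))"
proof (induction k)
  case 0
  then show ?case by (simp add: S_def)
next
  case (Suc k)
  have pk: "0 \<le> p k" for k
    using p(1) lift_Suc_mono_le[of p 0 k] p(2) by force
  have eq: "S (Suc k) = (\<lambda>\<omega>. S k \<omega> + \<zeta> k \<omega> * exp_remainder \<sigma> (p (Suc k) - p k) (W (p (Suc k)) \<omega> - W (p k) \<omega>))"
    by (simp add: S_def fun_eq_iff)
  have "S (Suc k) \<in> borel_measurable (\<F> P (p (Suc k)))"
  proof -
    have [measurable]: "S k \<in> borel_measurable (\<F> P (p (Suc k)))" "\<zeta> k \<in> borel_measurable (\<F> P (p (Suc k)))"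
      using Suc \<zeta>(1) p(2) by (auto intro: measurable_F_mono)
    have [measurable]: "W (p (Suc k)) \<in> borel_measurable (\<F> P (p (Suc k)))" "W (p k) \<in> borel_measurable (\<F> P (p (Suc k)))"
      using p(2) by (auto intro!: W_measurable_F pk)
    show ?thesis unfolding eq by measurable
  qed
  moreover note expectation_sq_add_remainder[OF pk p(2), of "S k" k "\<zeta> k" K \<sigma>]
  ultimately show ?case
    using Suc \<zeta> unfolding eq by (auto intro: order_trans)
qed

end

section \<open>The stochastic integral of an exponential martingale times a primitive\<close>

text \<open>Over a constant family the height of a simple process may be treated as a process that
  is known from time 0 on.\<close>

lemma progressively_measurable_random_variable:
  assumes "Y \<in> borel_measurable M"
  shows "progressively_measurable (\<lambda>_. M) (\<lambda>t. Y)"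
  by (rule progressively_measurableI, rule measurable_compose[OF measurable_snd assms])

lemma progressively_measurable_sum:
  assumes "\<And>i. i \<in> I \<Longrightarrow> progressively_measurable F (X i)"
  shows "progressively_measurable F (\<lambda>t \<omega>. \<Sum>i\<in>I. X i t \<omega>)"
  by (rule progressively_measurableI, rule borel_measurable_sum) (rule progressively_measurableD[OF assms])

definition exp_martingale :: "real \<Rightarrow> real \<Rightarrow> (real \<Rightarrow> real) \<Rightarrow> real" where
  "exp_martingale \<sigma> t \<omega> = exp (- \<sigma> * W t \<omega> - \<sigma>\<^sup>2 / 2 * t)"

text \<open>The ratio of two values depends on the increment alone: for increment x over a step v it
  is \<open>1 - \<sigma> * x + exp_remainder \<sigma> v x\<close>.\<close>

lemma exp_martingale_increment:
  "exp_martingale \<sigma> s \<omega> * exp (- \<sigma> * (W t \<omega> - W s \<omega>) - \<sigma>\<^sup>2 / 2 * (t - s)) = exp_martingale \<sigma> t \<omega>"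
  unfolding exp_martingale_def exp_add[symmetric] by (rule arg_cong[of _ _ exp]) (simp add: field_simps)

text \<open>By exp u - 1 - u <= u^2 on [0, 1], each summand is at most
  \<open>(real (Suc n) * \<sigma>)\<^sup>2\<close> times mesh times step. The steps sum to at most
  \<open>T\<close>, and (n + 1)^2 times the mesh is 1/(n + 1).\<close>

lemma sum_remainder_bound:
  assumes \<sigma>: "0 < \<sigma>" and T: "0 \<le> T" and small: "\<sigma>\<^sup>2 * (1 / real (Suc n) ^ 3) \<le> 1"
  shows "(\<Sum>i<steps n. (real (Suc n) / \<sigma>)\<^sup>2 *
      (exp (\<sigma>\<^sup>2 * (min (grid n (Suc i)) T - min (grid n i) T)) - 1
        - \<sigma>\<^sup>2 * (min (grid n (Suc i)) T - min (grid n i) T)))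
    \<le> \<sigma>\<^sup>2 * T * (1 / real (Suc n))"
proof -
  let ?m = "1 / real (Suc n) ^ 3" and ?d = "\<lambda>i. min (grid n (Suc i)) T - min (grid n i) T"
  have d: "0 \<le> ?d i" "?d i \<le> ?m" for i
    using min_grid_mono[of n i T] grid_step[of n i] grid_strict_mono[of n i] by linarith+
  have step: "(real (Suc n) / \<sigma>)\<^sup>2 * (exp (\<sigma>\<^sup>2 * ?d i) - 1 - \<sigma>\<^sup>2 * ?d i) \<le> (real (Suc n) * \<sigma>)\<^sup>2 * ?m * ?d i" for i
  proof -
    have "\<sigma>\<^sup>2 * ?d i \<le> \<sigma>\<^sup>2 * ?m"
      using d(2)[of i] by (intro mult_left_mono) auto
    then have "\<sigma>\<^sup>2 * ?d i \<le> 1" using small by linarith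
    then have "exp (\<sigma>\<^sup>2 * ?d i) - 1 - \<sigma>\<^sup>2 * ?d i \<le> (\<sigma>\<^sup>2 * ?d i)\<^sup>2"
      using exp_bound[of "\<sigma>\<^sup>2 * ?d i"] mult_nonneg_nonneg[OF zero_le_power2[of \<sigma>] d(1)[of i]] by linarith
    then have "(real (Suc n) / \<sigma>)\<^sup>2 * (exp (\<sigma>\<^sup>2 * ?d i) - 1 - \<sigma>\<^sup>2 * ?d i)
        \<le> (real (Suc n) / \<sigma>)\<^sup>2 * (\<sigma>\<^sup>2 * ?d i)\<^sup>2"
      by (rule mult_left_mono) simp
    also have "\<dots> = (real (Suc n) * \<sigma>)\<^sup>2 * (?d i * ?d i)"
      using \<sigma> by (simp add: power_divide power_mult_distrib power2_eq_square)
    also have "\<dots> \<le> (real (Suc n) * \<sigma>)\<^sup>2 * (?m * ?d i)"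
      by (intro mult_left_mono mult_right_mono d) auto
    finally show ?thesis by (simp only: mult.assoc)
  qed
  have "(\<Sum>i<steps n. (real (Suc n) / \<sigma>)\<^sup>2 * (exp (\<sigma>\<^sup>2 * ?d i) - 1 - \<sigma>\<^sup>2 * ?d i))
      \<le> (\<Sum>i<steps n. (real (Suc n) * \<sigma>)\<^sup>2 * ?m * ?d i)"
    by (rule sum_mono) (rule step)
  also have "\<dots> = (real (Suc n) * \<sigma>)\<^sup>2 * ?m * (min (grid n (steps n)) T - min (grid n 0) T)"
    unfolding sum_distrib_left[symmetric]
    by (simp only: sum_lessThan_telescope[of "\<lambda>i. min (grid n i) T"])
  also have "\<dots> \<le> (real (Suc n) * \<sigma>)\<^sup>2 * ?m * T"
    using T by (intro mult_left_mono) auto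
  also have "\<dots> = \<sigma>\<^sup>2 * T * (1 / real (Suc n))"
    by (simp add: power_mult_distrib power2_eq_square power3_eq_cube field_simps del: of_nat_Suc)
  finally show ?thesis .
qed

context wiener_space
begin

lemma exp_martingale_continuous:
  assumes "\<omega> \<in> path_space"
  shows "continuous_on {0..} (\<lambda>t. exp_martingale \<sigma> t \<omega>)"
  unfolding exp_martingale_def by (intro continuous_intros W_continuous assms)

lemma W_progressive: "progressively_measurable (\<F> P) W"
  by (rule progressively_measurable_continuous) (simp_all add: W_measurable_F W_continuous)

lemma remainder_tendsto_in_probability:
  assumes \<sigma>: "0 < \<sigma>" and T: "0 \<le> T"
    and \<xi>: "\<And>n i. \<xi> n i \<in> borel_measurable (\<F> P (grid n i))" "\<And>n i \<omega>. \<bar>\<xi> n i \<omega>\<bar> \<le> real (Suc n)"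
  defines "p \<equiv> \<lambda>n i. min (grid n i) T"
  shows "tendsto_in_probability (completion P)
    (\<lambda>n \<omega>. \<Sum>i<steps n. \<xi> n i \<omega> / \<sigma> *
      exp_remainder \<sigma> (p n (Suc i) - p n i) (W (p n (Suc i)) \<omega> - W (p n i) \<omega>)) (\<lambda>_. 0)"
proof -
  \<comment> \<open>Past \<open>T\<close> the stopped time is \<open>T\<close>, while
    \<open>\<xi> n i\<close> may depend on the path after \<open>T\<close>. The height is set to 0
    there, which changes no term because the remainder of an empty step vanishes.\<close>
  define \<zeta> where "\<zeta> n i \<omega> = (if grid n i \<le> T then \<xi> n i \<omega> / \<sigma> else 0)" for n i \<omega>
  define S where "S n k \<omega> = (\<Sum>i<k. \<zeta> n i \<omega> *
      exp_remainder \<sigma> (p n (Suc i) - p n i) (W (p n (Suc i)) \<omega> - W (p n i) \<omega>))" for n k \<omega>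
  have S: "S n (steps n) \<in> borel_measurable (\<F> P (p n (steps n))) \<and>
      integrable (completion P) (\<lambda>\<omega>. (S n (steps n) \<omega>)\<^sup>2) \<and>
      Q.expectation (\<lambda>\<omega>. (S n (steps n) \<omega>)\<^sup>2) \<le> (\<Sum>i<steps n. (real (Suc n) / \<sigma>)\<^sup>2 *
        (exp (\<sigma>\<^sup>2 * (p n (Suc i) - p n i)) - 1 - \<sigma>\<^sup>2 * (p n (Suc i) - p n i)))" for n
    unfolding S_def[abs_def]
  proof (rule expectation_sq_sum_remainder)
    show "0 \<le> p n 0" using T by (simp add: p_def)
    show "p n i \<le> p n (Suc i)" for i unfolding p_def by (rule min_grid_mono)
    show "\<zeta> n i \<in> borel_measurable (\<F> P (p n i))" for i
    proof (cases "grid n i \<le> T")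
      case True
      then have "p n i = grid n i" by (simp add: p_def)
      then show ?thesis
        using True \<xi>(1)[of n i] unfolding \<zeta>_def[abs_def] by simp
    next
      case False
      then show ?thesis by (simp add: \<zeta>_def[abs_def])
    qed
    show "\<bar>\<zeta> n i \<omega>\<bar> \<le> real (Suc n) / \<sigma>" for i \<omega>
      using \<sigma> divide_right_mono[OF \<xi>(2)[of n i \<omega>], of \<sigma>] by (simp add: \<zeta>_def)
  qed
  have eq: "(\<Sum>i<steps n. \<xi> n i \<omega> / \<sigma> * exp_remainder \<sigma> (p n (Suc i) - p n i) (W (p n (Suc i)) \<omega> - W (p n i) \<omega>))
      = S n (steps n) \<omega>" for n \<omega>
    unfolding S_def
  proof (rule sum.cong[OF refl])
    fix i
    show "\<xi> n i \<omega> / \<sigma> * exp_remainder \<sigma> (p n (Suc i) - p n i) (W (p n (Suc i)) \<omega> - W (p n i) \<omega>)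
        = \<zeta> n i \<omega> * exp_remainder \<sigma> (p n (Suc i) - p n i) (W (p n (Suc i)) \<omega> - W (p n i) \<omega>)"
    proof (cases "grid n i \<le> T")
      case False
      then have "p n i = T" "p n (Suc i) = T"
        using grid_strict_mono[of n i] unfolding p_def by linarith+
      then show ?thesis by (simp add: exp_remainder_def)
    qed (simp add: \<zeta>_def)
  qed
  show ?thesis
    unfolding eq
  proof (rule Q.tendsto_in_probability_L2)
    show "S n (steps n) \<in> borel_measurable (completion P)" for n
      using S[of n] by (blast intro: measurable_F_completion)
    show "integrable (completion P) (\<lambda>\<omega>. (S n (steps n) \<omega>)\<^sup>2)" for n
      using S[of n] by blast
    have "(\<lambda>n. \<sigma>\<^sup>2 * (1 / real (Suc n) ^ 3)) \<longlonglongrightarrow> \<sigma>\<^sup>2 * 0"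
      by (rule tendsto_mult[OF tendsto_const mesh_tendsto_0])
    then have "eventually (\<lambda>n. \<sigma>\<^sup>2 * (1 / real (Suc n) ^ 3) < 1) sequentially"
      by (rule order_tendstoD) simp
    then have "eventually (\<lambda>n. norm (Q.expectation (\<lambda>\<omega>. (S n (steps n) \<omega>)\<^sup>2)) \<le> \<sigma>\<^sup>2 * T * (1 / real (Suc n))) sequentially"
    proof eventually_elim
      case (elim n)
      have "Q.expectation (\<lambda>\<omega>. (S n (steps n) \<omega>)\<^sup>2) \<le> \<sigma>\<^sup>2 * T * (1 / real (Suc n))"
        using S[of n] sum_remainder_bound[OF \<sigma> T less_imp_le[OF elim]] unfolding p_def
        by linarith
      moreover have "0 \<le> Q.expectation (\<lambda>\<omega>. (S n (steps n) \<omega>)\<^sup>2)"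
        by (rule Bochner_Integration.integral_nonneg) simp
      ultimately show ?case by simp
    qed
    moreover have "(\<lambda>n. \<sigma>\<^sup>2 * T * (1 / real (Suc n))) \<longlonglongrightarrow> 0"
      using tendsto_mult[OF tendsto_const[of "\<sigma>\<^sup>2 * T"] LIMSEQ_inverse_real_of_nat]
      by (simp only: inverse_eq_divide mult_zero_right)
    ultimately show "(\<lambda>n. Q.expectation (\<lambda>\<omega>. (S n (steps n) \<omega>)\<^sup>2)) \<longlonglongrightarrow> 0"
      by (rule Lim_null_comparison)
  qed
qed

text \<open>\<open>z\<close> and \<open>Z\<close> are chosen path by path, since they serve pathwise
  limits only; measurability enters through \<open>X\<close> and \<open>I\<close>.\<close>

lemma is_ito_integral_exp_martingale_mult:
  assumes \<sigma>: "0 < \<sigma>" and X: "progressively_measurable (\<F> P) X" and I: "adapted (\<F> P) I"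
    and path: "AE \<omega> in completion P. \<exists>z Z. is_primitive z Z \<and>
      (\<forall>t\<ge>0. X t \<omega> = exp_martingale \<sigma> t \<omega> * Z t \<and>
        I t \<omega> = X t \<omega> - X 0 \<omega> - (LINT s:{0..t}|lborel. exp_martingale \<sigma> s \<omega> * z s))"
  shows "is_ito_integral (completion P) (\<F> P) W (\<lambda>t \<omega>. - \<sigma> * X t \<omega>) I"
proof -
  define M where "M = exp_martingale \<sigma>"
  define H where "H t \<omega> = - \<sigma> * X t \<omega>" for t \<omega>
  \<comment> \<open>Left-end values are known at the start of a cell; truncation makes them
    bounded.\<close>
  define \<xi> where "\<xi> n i \<omega> = clip (real (Suc n)) (H (grid n i) \<omega>)" for n i \<omega>
  have good: "AE \<omega> in completion P. \<omega> \<in> path_space \<and> (\<exists>z Z. is_primitive z Z \<and>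
      (\<forall>t\<ge>0. X t \<omega> = M t \<omega> * Z t \<and> I t \<omega> = X t \<omega> - X 0 \<omega> - (LINT s:{0..t}|lborel. M s \<omega> * z s)))"
    using path AE_space[of "completion P"] unfolding M_def by eventually_elim auto
  have contX: "continuous_on {0..} (\<lambda>t. X t \<omega>)"
    if "\<omega> \<in> path_space" "is_primitive z Z" "\<forall>t\<ge>0. X t \<omega> = M t \<omega> * Z t" for \<omega> z Z
  proof -
    have "continuous_on {0..} (\<lambda>t. M t \<omega> * Z t)"
      unfolding M_def by (intro continuous_on_mult exp_martingale_continuous is_primitive_continuous_on[OF that(2)] that(1))
    then show ?thesis
      using that(3) by (subst continuous_on_cong[OF refl, of _ _ "\<lambda>t. M t \<omega> * Z t"]) auto
  qed
  have contH: "AE \<omega> in completion P. continuous_on {0..} (\<lambda>t. H t \<omega>)"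
    using good
  proof eventually_elim
    case (elim \<omega>)
    then show ?case
      unfolding H_def using contX by (intro continuous_on_mult continuous_on_const) blast
  qed
  have contI: "continuous_process (completion P) I"
    unfolding continuous_process_def using good
  proof eventually_elim
    case (elim \<omega>)
    then obtain z Z where \<omega>: "\<omega> \<in> path_space" and Z: "is_primitive z Z" "\<forall>t\<ge>0. X t \<omega> = M t \<omega> * Z t"
      and I: "\<forall>t\<ge>0. I t \<omega> = X t \<omega> - X 0 \<omega> - (LINT s:{0..t}|lborel. M s \<omega> * z s)"
      by blast
    have "continuous_on {0..} (\<lambda>t. X t \<omega> - X 0 \<omega> - (LINT s:{0..t}|lborel. M s \<omega> * z s))"
      unfolding M_def
      by (intro continuous_on_diff continuous_on_const contX[OF \<omega> Z] is_primitive_continuous_on[OF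
            is_primitive_continuous_mult[OF exp_martingale_continuous[OF \<omega>] Z(1)]])
    then show ?case
      using I by (subst continuous_on_cong[OF refl, of _ _ "\<lambda>t. X t \<omega> - X 0 \<omega> - (LINT s:{0..t}|lborel. M s \<omega> * z s)"]) auto
  qed
  have progH: "progressively_measurable (\<F> P) H"
    unfolding H_def by (rule progressively_measurable_compose[OF X]) simp
  have progHQ: "progressively_measurable (\<lambda>_. completion P) H"
    by (rule progressively_measurable_mono[OF progH]) (simp_all add: sets_F_subset)
  have adH: "H t \<in> borel_measurable (\<F> P t)" if "0 \<le> t" for t
    using progressively_measurable_adapted[OF progH] that by (simp add: adapted_def)
  have \<xi>F: "\<xi> n i \<in> borel_measurable (\<F> P (grid n i))" for n i
    unfolding \<xi>_def by (rule measurable_compose[OF adH borel_measurable_clip]) simp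
  have \<xi>Q: "\<xi> n i \<in> borel_measurable (completion P)" for n i
    by (rule measurable_F_completion[OF \<xi>F])
  have \<xi>_bound: "\<bar>\<xi> n i \<omega>\<bar> \<le> real (Suc n)" for n i \<omega>
    unfolding \<xi>_def by (rule abs_clip_le) simp
  have WQ: "W t \<in> borel_measurable (completion P)" if "0 \<le> t" for t
    by (rule measurable_F_completion[OF W_measurable_F[OF that order_refl]])
  have IQ: "I t \<in> borel_measurable (completion P)" if "0 \<le> t" for t
    using I that by (auto simp: adapted_def intro: measurable_F_completion)
  have lsi: "locally_square_integrable (completion P) (\<F> P) H"
    unfolding locally_square_integrable_def
  proof (intro conjI progH)
    show "AE \<omega> in completion P. \<forall>T\<ge>0. set_integrable lborel {0..T} (\<lambda>s. (H s \<omega>)\<^sup>2)"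
      using contH
    proof eventually_elim
      case (elim \<omega>)
      then show ?case
        by (intro allI impI set_integrable_continuous continuous_on_power)
          (rule continuous_on_subset, assumption, auto)
    qed
  qed
  have simple: "simple_integrand (\<F> P) (steps n) (grid n) (\<xi> n)" for n
    unfolding simple_integrand_def using \<xi>F
    by (auto intro!: exI[of _ "real (Suc n)"] \<xi>_bound simp del: of_nat_Suc)
  have L2: "tendsto_in_probability (completion P)
      (\<lambda>n \<omega>. LINT s:{0..T}|lborel. (simple_process (steps n) (grid n) (\<xi> n) s \<omega> - H s \<omega>)\<^sup>2) (\<lambda>_. 0)"
    if T: "0 \<le> T" for T
  proof (rule Q.tendsto_in_probability_AE)
    fix n
    \<comment> \<open>The integral is the value at time \<open>T\<close> of a process that is
      progressive for the constant family, which settles its measurability.\<close>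
    have "progressively_measurable (\<lambda>_. completion P)
        (\<lambda>s \<omega>. (simple_process (steps n) (grid n) (\<xi> n) s \<omega> + - 1 * H s \<omega>)\<^sup>2)"
      unfolding simple_process_def
      by (intro progressively_measurable_compose[where \<phi>="\<lambda>x. x\<^sup>2"] progressively_measurable_add
          progressively_measurable_sum progressively_measurable_mult progressively_measurable_time
          progressively_measurable_random_variable \<xi>Q progHQ) auto
    then have "adapted (\<lambda>_. completion P) (\<lambda>t \<omega>. LINT s:{0..t}|lborel.
        (simple_process (steps n) (grid n) (\<xi> n) s \<omega> + - 1 * H s \<omega>)\<^sup>2)"
      by (intro progressively_measurable_adapted progressively_measurable_LINT)
    with T show "(\<lambda>\<omega>. LINT s:{0..T}|lborel. (simple_process (steps n) (grid n) (\<xi> n) s \<omega> - H s \<omega>)\<^sup>2)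
        \<in> borel_measurable (completion P)"
      by (simp add: adapted_def)
  next
    show "AE \<omega> in completion P. (\<lambda>n. LINT s:{0..T}|lborel.
        (simple_process (steps n) (grid n) (\<xi> n) s \<omega> - H s \<omega>)\<^sup>2) \<longlonglongrightarrow> 0"
      using contH
    proof eventually_elim
      case (elim \<omega>)
      from clipped_grid_L2_limit[OF this T] show ?case
        by (simp only: simple_process_def \<xi>_def)
    qed
  qed simp
  have int: "tendsto_in_probability (completion P) (\<lambda>n. simple_integral W (steps n) (grid n) (\<xi> n) T) (I T)"
    if T: "0 \<le> T" for T
  proof -
    define p where "p n i = min (grid n i) T" for n i
    \<comment> \<open>\<open>q\<close> is the ratio of consecutive values of \<open>M\<close>, and
      \<open>- \<xi> n i \<omega> / \<sigma>\<close> a truncated left-end value of \<open>X\<close>.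
      Hence \<open>S\<close> can be treated path by path, while \<open>R\<close> gathers the
      Gaussian remainders, which are small in L^2.\<close>
    define q where "q n i \<omega> = exp (- \<sigma> * (W (p n (Suc i)) \<omega> - W (p n i) \<omega>) - \<sigma>\<^sup>2 / 2 * (p n (Suc i) - p n i))" for n i \<omega>
    define S where "S n \<omega> = (\<Sum>i<steps n. - \<xi> n i \<omega> / \<sigma> * (q n i \<omega> - 1))" for n \<omega>
    define R where "R n \<omega> = (\<Sum>i<steps n. \<xi> n i \<omega> / \<sigma> *
        exp_remainder \<sigma> (p n (Suc i) - p n i) (W (p n (Suc i)) \<omega> - W (p n i) \<omega>))" for n \<omega>
    have p0: "0 \<le> p n i" for n i using T by (simp add: p_def)
    have [measurable]: "W (p n i) \<in> borel_measurable (completion P)" "\<xi> n i \<in> borel_measurable (completion P)" for n i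
      by (rule WQ[OF p0], rule \<xi>Q)
    have SQ: "S n \<in> borel_measurable (completion P)" for n
      unfolding S_def[abs_def] q_def by measurable
    have RQ: "R n \<in> borel_measurable (completion P)" for n
      unfolding R_def[abs_def] by measurable
    have split: "simple_integral W (steps n) (grid n) (\<xi> n) T = (\<lambda>\<omega>. S n \<omega> + R n \<omega>)" for n
    proof
      fix \<omega>
      have "\<xi> n i \<omega> * (W (p n (Suc i)) \<omega> - W (p n i) \<omega>) = - \<xi> n i \<omega> / \<sigma> * (q n i \<omega> - 1)
          + \<xi> n i \<omega> / \<sigma> * exp_remainder \<sigma> (p n (Suc i) - p n i) (W (p n (Suc i)) \<omega> - W (p n i) \<omega>)" for i
      proof -
        have "exp_remainder \<sigma> (p n (Suc i) - p n i) (W (p n (Suc i)) \<omega> - W (p n i) \<omega>)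
            = q n i \<omega> - 1 + \<sigma> * (W (p n (Suc i)) \<omega> - W (p n i) \<omega>)"
          unfolding exp_remainder_def q_def ..
        moreover have "x * D = - x / \<sigma> * (Q - 1) + x / \<sigma> * (Q - 1 + \<sigma> * D)" for x D Q
          using \<sigma> by (simp add: field_simps)
        ultimately show ?thesis by presburger
      qed
      then show "simple_integral W (steps n) (grid n) (\<xi> n) T \<omega> = S n \<omega> + R n \<omega>"
        by (simp only: simple_integral_def p_def[symmetric] S_def R_def sum.distrib[symmetric])
    qed
    have Slim: "AE \<omega> in completion P. (\<lambda>n. S n \<omega>) \<longlonglongrightarrow> I T \<omega>"
      using good contH
    proof eventually_elim
      case (elim \<omega>)
      then obtain z Z where \<omega>: "\<omega> \<in> path_space" and Z: "is_primitive z Z" and XZ: "\<forall>t\<ge>0. X t \<omega> = M t \<omega> * Z t"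
        and I: "\<forall>t\<ge>0. I t \<omega> = X t \<omega> - X 0 \<omega> - (LINT s:{0..t}|lborel. M s \<omega> * z s)"
        by blast
      \<comment> \<open>Discrete product rule for \<open>X = M * Z\<close>, available once the
        truncation is inactive; cells past \<open>T\<close> contribute 0 on both sides.\<close>
      have term_eq: "- \<xi> n i \<omega> / \<sigma> * (q n i \<omega> - 1) =
          (X (p n (Suc i)) \<omega> - X (p n i) \<omega>) - M (p n (Suc i)) \<omega> * (Z (p n (Suc i)) - Z (p n i))"
        if clip: "\<forall>s\<in>{0..T}. clip (real (Suc n)) (H s \<omega>) = H s \<omega>" for n i
      proof -
        have "- \<xi> n i \<omega> / \<sigma> * (q n i \<omega> - 1) = X (p n i) \<omega> * (q n i \<omega> - 1)"
        proof (cases "grid n i \<le> T")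
          case True
          then show ?thesis
            using clip \<sigma> by (simp add: \<xi>_def p_def H_def)
        next
          case False
          then have "p n i = T" "p n (Suc i) = T"
            using grid_strict_mono[of n i] unfolding p_def by linarith+
          then show ?thesis by (simp add: q_def)
        qed
        moreover have "M (p n i) \<omega> * q n i \<omega> = M (p n (Suc i)) \<omega>"
          unfolding M_def q_def by (rule exp_martingale_increment)
        moreover have "X (p n i) \<omega> = M (p n i) \<omega> * Z (p n i)" "X (p n (Suc i)) \<omega> = M (p n (Suc i)) \<omega> * Z (p n (Suc i))"
          using XZ p0 by blast+
        ultimately show ?thesis
          by (simp add: algebra_simps)
      qed
      have "eventually (\<lambda>n. X T \<omega> - X 0 \<omega> - (\<Sum>i<steps n. M (p n (Suc i)) \<omega> * (Z (p n (Suc i)) - Z (p n i))) = S n \<omega>) sequentially"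
        using eventually_clip_grid[OF elim(2), of T] eventually_grid_steps[of T]
      proof eventually_elim
        case (elim n)
        show ?case
          unfolding S_def term_eq[OF elim(1)] sum_subtractf[of "\<lambda>i. X (p n (Suc i)) \<omega> - X (p n i) \<omega>"]
          using sum_grid_telescope[OF elim(2) T, of "\<lambda>t. X t \<omega>"] by (simp only: p_def)
      qed
      \<comment> \<open>The right-end tag looks into the future, which is harmless: the path is
        fixed and \<open>Z\<close> has bounded variation on [0, T].\<close>
      moreover have "(\<lambda>n. X T \<omega> - X 0 \<omega> - (\<Sum>i<steps n. M (p n (Suc i)) \<omega> * (Z (p n (Suc i)) - Z (p n i))))
          \<longlonglongrightarrow> X T \<omega> - X 0 \<omega> - (LINT s:{0..T}|lborel. M s \<omega> * z s)"
        unfolding p_def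
      proof (intro tendsto_diff tendsto_const riemann_stieltjes_limit[where \<tau>="\<lambda>n i. min (grid n (Suc i)) T"] Z T)
        show "continuous_on {0..} (\<lambda>s. M s \<omega>)"
          unfolding M_def by (rule exp_martingale_continuous[OF \<omega>])
        show "min (grid n (Suc i)) T \<in> {min (grid n i) T..min (grid n (Suc i)) T}" for n i
          using min_grid_mono[of n i T] by (simp only: atLeastAtMost_iff order_refl simp_thms)
      qed
      ultimately have "(\<lambda>n. S n \<omega>) \<longlonglongrightarrow> X T \<omega> - X 0 \<omega> - (LINT s:{0..T}|lborel. M s \<omega> * z s)"
        by (rule Lim_transform_eventually[rotated])
      then show ?case
        using I T by simp
    qed
    have "tendsto_in_probability (completion P) (\<lambda>n \<omega>. S n \<omega> + R n \<omega>) (\<lambda>\<omega>. I T \<omega> + 0)"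
    proof (rule Q.tendsto_in_probability_add[OF SQ RQ IQ[OF T] borel_measurable_const])
      show "tendsto_in_probability (completion P) S (I T)"
        by (rule Q.tendsto_in_probability_AE[OF SQ IQ[OF T] Slim])
      show "tendsto_in_probability (completion P) R (\<lambda>_. 0)"
        unfolding R_def[abs_def] p_def by (rule remainder_tendsto_in_probability[OF \<sigma> T \<xi>F \<xi>_bound])
    qed
    then show ?thesis
      by (simp only: split add_0_right)
  qed
  show ?thesis
    unfolding is_ito_integral_def H_def[symmetric]
    using lsi I contI simple L2 int by blast
qed

section \<open>From a pathwise factorisation to a strong solution\<close>

text \<open>The equation forces \<open>I\<close> to be \<open>X\<close> minus its drift integral, so
  what remains is that this process is an Ito integral. The pathwise hypothesis provides that,
  \<open>z\<close> being the drift divided by the exponential martingale.\<close>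

lemma solves_sdeI:
  assumes \<sigma>: "0 < \<sigma>" and c: "progressively_measurable (\<F> P) c" and X: "progressively_measurable (\<F> P) X"
    and nonneg: "\<And>t \<omega>. 0 \<le> t \<Longrightarrow> \<omega> \<in> path_space \<Longrightarrow> 0 \<le> X t \<omega>"
    and init: "\<And>\<omega>. \<omega> \<in> path_space \<Longrightarrow> X 0 \<omega> = 0"
    and path: "AE \<omega> in completion P. \<exists>z Z. is_primitive z Z \<and>
      (\<forall>t\<ge>0. X t \<omega> = exp_martingale \<sigma> t \<omega> * Z t \<and>
        exp_martingale \<sigma> t \<omega> * z t = X t \<omega> powr \<alpha> - \<mu> * X t \<omega> - c t \<omega> * X t \<omega>)"
  shows "solves_sde P \<alpha> \<sigma> \<mu> c X"
proof -
  let ?\<beta> = "\<lambda>t \<omega>. X t \<omega> powr \<alpha> - \<mu> * X t \<omega> - c t \<omega> * X t \<omega>"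
  let ?M = "exp_martingale \<sigma>"
  define I where "I t \<omega> = X t \<omega> - (LINT s:{0..t}|lborel. ?\<beta> s \<omega>)" for t \<omega>
  have "progressively_measurable (\<F> P) (\<lambda>t \<omega>. (\<lambda>x. x powr \<alpha> - \<mu> * x) (X t \<omega>) + (- 1) * (c t \<omega> * X t \<omega>))"
    by (intro progressively_measurable_add progressively_measurable_mult c X
        progressively_measurable_compose[OF X] progressively_measurable_time) measurable
  then have \<beta>: "progressively_measurable (\<F> P) ?\<beta>"
    by simp
  have "progressively_measurable (\<F> P) (\<lambda>t \<omega>. X t \<omega> + (- 1) * (LINT s:{0..t}|lborel. ?\<beta> s \<omega>))"
    by (rule progressively_measurable_add[OF X progressively_measurable_mult[OF
        progressively_measurable_time progressively_measurable_LINT[OF \<beta>]]]) simp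
  then have adI: "adapted (\<F> P) I"
    unfolding I_def by (intro progressively_measurable_adapted) simp
  have good: "AE \<omega> in completion P. \<omega> \<in> path_space \<and> (\<exists>z Z. is_primitive z Z \<and>
      (\<forall>t\<ge>0. X t \<omega> = ?M t \<omega> * Z t) \<and> (\<forall>t\<ge>0. ?M t \<omega> * z t = ?\<beta> t \<omega>))"
    using path AE_space[of "completion P"] by eventually_elim auto
  have LINT_eq: "(LINT s:{0..t}|lborel. ?M s \<omega> * z s) = (LINT s:{0..t}|lborel. ?\<beta> s \<omega>)"
    if "\<forall>t\<ge>0. ?M t \<omega> * z t = ?\<beta> t \<omega>" for \<omega> z t
    using that by (intro set_lebesgue_integral_cong) auto
  have "is_ito_integral (completion P) (\<F> P) W (\<lambda>t \<omega>. - \<sigma> * X t \<omega>) I"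
  proof (rule is_ito_integral_exp_martingale_mult[OF \<sigma> X adI])
    show "AE \<omega> in completion P. \<exists>z Z. is_primitive z Z \<and> (\<forall>t\<ge>0. X t \<omega> = ?M t \<omega> * Z t \<and>
        I t \<omega> = X t \<omega> - X 0 \<omega> - (LINT s:{0..t}|lborel. ?M s \<omega> * z s))"
      using good
    proof eventually_elim
      case (elim \<omega>)
      then obtain z Z where Z: "\<omega> \<in> path_space" "is_primitive z Z" "\<forall>t\<ge>0. X t \<omega> = ?M t \<omega> * Z t"
          "\<forall>t\<ge>0. ?M t \<omega> * z t = ?\<beta> t \<omega>"
        by blast
      have "I t \<omega> = X t \<omega> - X 0 \<omega> - (LINT s:{0..t}|lborel. ?M s \<omega> * z s)" for t
        unfolding LINT_eq[OF Z(4)] by (simp add: I_def init[OF Z(1)])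
      with Z show ?case by blast
    qed
  qed
  moreover have "AE \<omega> in completion P. \<forall>t\<ge>0. set_integrable lborel {0..t} (\<lambda>s. ?\<beta> s \<omega>) \<and>
      X t \<omega> = 0 + (LINT s:{0..t}|lborel. ?\<beta> s \<omega>) + I t \<omega>"
    using good
  proof eventually_elim
    case (elim \<omega>)
    then obtain z Z where Z: "\<omega> \<in> path_space" "is_primitive z Z" "\<forall>t\<ge>0. ?M t \<omega> * z t = ?\<beta> t \<omega>"
      by blast
    have "set_integrable lborel {0..t} (\<lambda>s. ?\<beta> s \<omega>)" if "0 \<le> t" for t
    proof -
      have "set_integrable lborel {0..t} (\<lambda>s. ?M s \<omega> * z s)"
        by (rule is_primitiveD(1)[OF is_primitive_continuous_mult[OF exp_martingale_continuous[OF Z(1)] Z(2)] that])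
      also have "?this \<longleftrightarrow> ?thesis"
        using Z(3) by (intro set_integrable_cong) auto
      finally show ?thesis .
    qed
    then show ?case by (simp add: I_def)
  qed
  moreover have "continuous_process (completion P) X"
    unfolding continuous_process_def using good
  proof eventually_elim
    case (elim \<omega>)
    then obtain z Z where Z: "\<omega> \<in> path_space" "is_primitive z Z" "\<forall>t\<ge>0. X t \<omega> = ?M t \<omega> * Z t"
      by blast
    have "continuous_on {0..} (\<lambda>t. ?M t \<omega> * Z t)"
      by (intro continuous_on_mult exp_martingale_continuous is_primitive_continuous_on[OF Z(2)] Z(1))
    then show ?case
      using Z(3) by (subst continuous_on_cong[OF refl, of _ _ "\<lambda>t. ?M t \<omega> * Z t"]) auto
  qed
  ultimately show ?thesis
    unfolding solves_sde_def strong_solution_def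
    using progressively_measurable_adapted[OF X] nonneg init
    by (intro conjI exI[of _ I]) simp_all
qed

end

section \<open>The two solutions\<close>

text \<open>A positive continuous function has a positive minimum on a compact interval.\<close>

lemma LINT_pos:
  fixes f :: "real \<Rightarrow> real"
  assumes f: "continuous_on {0..t} f" and t: "0 < t" and pos: "\<And>s. s \<in> {0..t} \<Longrightarrow> 0 < f s"
  shows "0 < (LINT s:{0..t}|lborel. f s)"
proof -
  have "{0..t} \<noteq> {}" using t by simp
  from continuous_attains_inf[OF compact_Icc this f]
  obtain x where x: "x \<in> {0..t}" "\<And>s. s \<in> {0..t} \<Longrightarrow> f x \<le> f s"
    by blast
  have "0 < f x * t"
    using pos[OF x(1)] t by simp
  also have "f x * t = (LINT s:{0..t}|lborel. f x)"
    using t by (simp add: set_lebesgue_integral_def)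
  also have "\<dots> \<le> (LINT s:{0..t}|lborel. f s)"
    by (intro set_integral_mono set_integrable_continuous f continuous_on_const x(2))
  finally show ?thesis .
qed

lemma LINT_const: "0 \<le> t \<Longrightarrow> (LINT s:{0..t}|lborel. k) = k * (t::real)" for k :: real
  by (simp add: set_lebesgue_integral_def)

lemma X_tilde_path:
  assumes \<alpha>: "0 < \<alpha>" "\<alpha> < 1" and \<mu>: "0 < \<mu>"
    and W: "continuous_on {0..} (\<lambda>t. W t \<omega>)"
    and c: "\<And>t. 0 \<le> t \<Longrightarrow> set_integrable lborel {0..t} (\<lambda>s. c s \<omega>)" "\<And>t. 0 \<le> t \<Longrightarrow> 0 \<le> c t \<omega>"
  shows "\<exists>z Z. is_primitive z Z \<and> (\<forall>t\<ge>0. X_tilde \<alpha> \<sigma> \<mu> c t \<omega> = exp_martingale \<sigma> t \<omega> * Z t \<and>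
      exp_martingale \<sigma> t \<omega> * z t =
        X_tilde \<alpha> \<sigma> \<mu> c t \<omega> powr \<alpha> - \<mu> * X_tilde \<alpha> \<sigma> \<mu> c t \<omega> - c t \<omega> * X_tilde \<alpha> \<sigma> \<mu> c t \<omega>)"
    and "\<And>t. 0 < t \<Longrightarrow> 0 < X_tilde \<alpha> \<sigma> \<mu> c t \<omega>"
proof -
  define a where "a = 1 - \<alpha>"
  have a: "0 < a" "\<alpha> = 1 - a" using \<alpha> by (auto simp: a_def)
  define A where "A t = (LINT s:{0..t}|lborel. \<mu> + c s \<omega>)" for t
  \<comment> \<open>\<open>exp (- y t)\<close> is the exponential martingale times
    \<open>exp (- A t)\<close>, the solution started at 1 of the linear part of the
    equation.\<close>
  define y where "y t = A t + \<sigma>\<^sup>2 / 2 * t + \<sigma> * W t \<omega>" for t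
  define G where "G t = G_process \<alpha> \<sigma> \<mu> c t \<omega>" for t
  define J where "J t = (LINT s:{0..t}|lborel. G s)" for t
  \<comment> \<open>The nonzero branch of h' = h^\<alpha> G starting at 0.\<close>
  define h where "h t = (a * J t) powr (1 / a)" for t
  let ?X = "\<lambda>t. X_tilde \<alpha> \<sigma> \<mu> c t \<omega>"
  have ic: "set_integrable lborel {0..t} (\<lambda>s. \<mu> + c s \<omega>)" if "0 \<le> t" for t
    by (intro set_integral_add(1) set_integrable_continuous continuous_on_const c(1) that)
  have A: "is_primitive (\<lambda>s. \<mu> + c s \<omega>) A"
    unfolding A_def by (rule is_primitive_LINT[OF ic])
  have A0: "0 \<le> A t" if "0 \<le> t" for t
    unfolding A_def set_lebesgue_integral_def using c(2) \<mu>
    by (intro Bochner_Integration.integral_nonneg) (auto simp: indicator_def intro!: add_nonneg_nonneg)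
  have cA: "continuous_on {0..} A"
    by (rule is_primitive_continuous_on[OF A])
  have G_eq: "G t = exp (a * y t)" if t: "0 \<le> t" for t
  proof -
    \<comment> \<open>The corrections a \<alpha> / 2 from \<open>b_process\<close> and a^2 / 2 add
      up to a / 2 times the squared volatility, because \<alpha> + a = 1.\<close>
    have "(LINT s:{0..t}|lborel. - b_process \<alpha> \<sigma> \<mu> c s \<omega> + \<sigma>\<^sup>2 * a\<^sup>2 / 2)
        = (LINT s:{0..t}|lborel. a * (\<mu> + c s \<omega>) + a * \<sigma>\<^sup>2 / 2)"
      by (rule arg_cong[of _ _ "set_lebesgue_integral lborel {0..t}"], rule ext)
        (simp add: b_process_def a(2) power2_eq_square field_simps)
    also have "\<dots> = a * A t + a * \<sigma>\<^sup>2 / 2 * t"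
      unfolding A_def using ic[OF t] LINT_const[OF t, of "a * \<sigma>\<^sup>2 / 2"]
        set_integrable_continuous[OF continuous_on_const, of 0 t "a * \<sigma>\<^sup>2 / 2"]
      by (subst set_integral_add(2)) auto
    finally show ?thesis
      by (simp add: G_def G_process_def a_def[symmetric] y_def algebra_simps)
  qed
  have cy: "continuous_on {0..} y"
    unfolding y_def by (intro continuous_intros cA W)
  have cG: "continuous_on {0..} G"
  proof (subst continuous_on_cong[OF refl])
    show "continuous_on {0..} (\<lambda>t. exp (a * y t))"
      by (intro continuous_intros cy)
  qed (simp add: G_eq)
  have J: "is_primitive G J"
    unfolding J_def by (rule is_primitive_continuous_LINT[OF cG])
  have Jpos: "0 < J t" if "0 < t" for t
    unfolding J_def by (rule LINT_pos[OF continuous_on_subset[OF cG] that]) (auto simp: G_eq)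
  have J_0: "J 0 = 0"
    using is_primitiveD(2)[OF J, of 0] by (simp add: J_def)
  have J0: "0 \<le> J t" if "0 \<le> t" for t
    using Jpos[of t] J_0 that by (cases "t = 0") auto
  have E: "is_primitive (\<lambda>t. - exp (- A t) * (\<mu> + c t \<omega>)) (\<lambda>t. exp (- A t))"
    by (rule is_primitive_compose[where \<phi>="\<lambda>x. exp (- x)" and \<phi>'="\<lambda>x. - exp (- x)", OF A A0])
      (auto intro!: continuous_intros derivative_eq_intros)
  have H: "is_primitive (\<lambda>t. (a * J t) powr (\<alpha> / a) * G t) h"
    unfolding h_def
  \<comment> \<open>The exponent 1/a - 1 = \<alpha>/a is positive, so the derivative extends
    continuously by 0 to the starting point \<open>J 0 = 0\<close>.\<close>
  proof (rule is_primitive_compose[where \<phi>="\<lambda>x. (a * x) powr (1 / a)" and \<phi>'="\<lambda>x. (a * x) powr (\<alpha> / a)", OF J J0])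
    show "continuous_on {0..} (\<lambda>x. (a * x) powr (1 / a))" "continuous_on {0..} (\<lambda>x. (a * x) powr (\<alpha> / a))"
      using a(1) \<alpha>(1) by (intro continuous_on_powr' continuous_intros; simp)+
    show "((\<lambda>x. (a * x) powr (1 / a)) has_real_derivative (a * x) powr (\<alpha> / a)) (at x)" if x: "0 < x" for x
    proof -
      have "((\<lambda>x. (a * x) powr (1 / a)) has_real_derivative 1 / a * (a * x) powr (1 / a - 1) * a) (at x)"
        using x a by (auto intro!: derivative_eq_intros)
      moreover have "1 / a - 1 = \<alpha> / a"
        using a by (simp add: field_simps)
      ultimately show ?thesis using a(1) by simp
    qed
  qed
  define z where "z t = exp (- A t) * ((a * J t) powr (\<alpha> / a) * G t) + h t * (- exp (- A t) * (\<mu> + c t \<omega>))" for t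
  have Z: "is_primitive z (\<lambda>t. exp (- A t) * h t)"
    unfolding z_def by (rule is_primitive_mult[OF E H])
  have M: "exp_martingale \<sigma> t \<omega> * exp (- A t) = exp (- y t)" for t
    unfolding exp_martingale_def y_def exp_add[symmetric] by (simp add: algebra_simps)
  have X: "?X t = exp (- y t) * h t" if t: "0 \<le> t" for t
  proof (cases "t = 0")
    case True
    then show ?thesis by (simp add: X_tilde_def h_def J_0)
  next
    case False
    have "?X t = (a / G t * J t) powr (1 / a)"
      using False by (simp add: X_tilde_def G_def J_def a_def)
    also have "a / G t * J t = exp (- (a * y t)) * (a * J t)"
      by (simp add: G_eq[OF t] exp_minus divide_inverse mult.commute)
    also have "\<dots> powr (1 / a) = exp (- y t) * h t"
      using a(1) J0[OF t] by (simp add: powr_mult h_def exp_powr_real)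
    finally show ?thesis .
  qed
  show "0 < ?X t" if "0 < t" for t
    using X[of t] Jpos[OF that] that a(1) by (simp add: h_def)
  have drift: "exp_martingale \<sigma> t \<omega> * z t = ?X t powr \<alpha> - \<mu> * ?X t - c t \<omega> * ?X t" if t: "0 \<le> t" for t
  proof -
    \<comment> \<open>Here the power of the noise left by G becomes the one in the nonlinear drift:
      a - 1 = -\<alpha>.\<close>
    have "exp (- y t) * G t = exp (- \<alpha> * y t)"
      unfolding G_eq[OF t] exp_add[symmetric] by (simp add: a(2) algebra_simps)
    moreover have "?X t powr \<alpha> = exp (- \<alpha> * y t) * (a * J t) powr (\<alpha> / a)"
      unfolding X[OF t] using a(1) J0[OF t] by (simp add: powr_mult h_def exp_powr_real powr_powr mult.commute)
    moreover have "exp_martingale \<sigma> t \<omega> * z t =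
        exp (- y t) * G t * (a * J t) powr (\<alpha> / a) - (\<mu> + c t \<omega>) * (exp (- y t) * h t)"
      unfolding z_def M[symmetric] by (simp add: algebra_simps)
    ultimately show ?thesis
      unfolding X[OF t] by (simp add: algebra_simps)
  qed
  have "?X t = exp_martingale \<sigma> t \<omega> * (exp (- A t) * h t)" if "0 \<le> t" for t
    using X[OF that] by (simp add: M[symmetric])
  with Z drift show "\<exists>z Z. is_primitive z Z \<and> (\<forall>t\<ge>0. ?X t = exp_martingale \<sigma> t \<omega> * Z t \<and>
      exp_martingale \<sigma> t \<omega> * z t = ?X t powr \<alpha> - \<mu> * ?X t - c t \<omega> * ?X t)"
    by blast
qed

section \<open>Measurability of the positive solution and integrability of the control\<close>

lemma (in wiener_space) X_tilde_progressive:
  assumes c: "progressively_measurable (\<F> P) c"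
  shows "progressively_measurable (\<F> P) (X_tilde \<alpha> \<sigma> \<mu> c)"
proof -
  let ?a = "1 - \<alpha>" and ?G = "G_process \<alpha> \<sigma> \<mu> c"
  have "progressively_measurable (\<F> P) (\<lambda>s \<omega>. - b_process \<alpha> \<sigma> \<mu> c s \<omega> + \<sigma>\<^sup>2 * ?a\<^sup>2 / 2)"
    unfolding b_process_def by (rule progressively_measurable_compose[OF c]) measurable
  note integral = progressively_measurable_LINT[OF this]
  have "progressively_measurable (\<F> P) (\<lambda>t \<omega>. \<sigma> * ?a * W t \<omega>)"
    by (rule progressively_measurable_compose[OF W_progressive]) measurable
  from progressively_measurable_compose[OF progressively_measurable_add[OF integral this], of exp]
  have G: "progressively_measurable (\<F> P) ?G"
    unfolding G_process_def[abs_def] Let_def by simp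
  have "progressively_measurable (\<F> P) (\<lambda>t \<omega>. ?a / ?G t \<omega> * (LINT s:{0..t}|lborel. ?G s \<omega>))"
    by (rule progressively_measurable_mult[OF progressively_measurable_compose[OF G] progressively_measurable_LINT[OF G]])
      measurable
  then have powr: "progressively_measurable (\<F> P)
      (\<lambda>t \<omega>. (?a / ?G t \<omega> * (LINT s:{0..t}|lborel. ?G s \<omega>)) powr (1 / ?a))"
    by (rule progressively_measurable_compose) measurable
  \<comment> \<open>The case distinction at time 0 is rewritten as a deterministic factor.\<close>
  have "progressively_measurable (\<F> P) (\<lambda>t \<omega>. indicator (- {0}) t *
      (?a / ?G t \<omega> * (LINT s:{0..t}|lborel. ?G s \<omega>)) powr (1 / ?a))"
    by (rule progressively_measurable_mult[OF progressively_measurable_time powr]) measurable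
  moreover have "X_tilde \<alpha> \<sigma> \<mu> c = (\<lambda>t \<omega>. indicator (- {0}) t *
      (?a / ?G t \<omega> * (LINT s:{0..t}|lborel. ?G s \<omega>)) powr (1 / ?a))"
    by (simp add: X_tilde_def fun_eq_iff indicator_def)
  ultimately show ?thesis by simp
qed

text \<open>Finiteness of a nonnegative integral becomes Bochner integrability once each path is
  measurable in time, and paths are sections of a jointly measurable function.\<close>

lemma (in wiener_space) AE_set_integrable_control:
  assumes c: "c \<in> \<C> P"
  shows "AE \<omega> in completion P. \<forall>t\<ge>0. set_integrable lborel {0..t} (\<lambda>s. c s \<omega>)"
proof -
  have "AE \<omega> in completion P. \<forall>t>0. (\<integral>\<^sup>+ s\<in>{0..t}. ennreal (c s \<omega>) \<partial>lborel) < \<infinity>"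
    using c by (simp add: \<C>_def)
  moreover have "AE \<omega> in completion P. \<omega> \<in> path_space"
    using AE_space[of "completion P"] by simp
  ultimately show ?thesis
  proof eventually_elim
    case (elim \<omega>)
    have int: "set_integrable lborel {0..t} (\<lambda>s. c s \<omega>)" if t: "0 < t" for t
      unfolding set_integrable_def
    proof (rule integrableI_nonneg)
      show "(\<lambda>s. indicator {0..t} s *\<^sub>R c s \<omega>) \<in> borel_measurable lborel"
        using progressively_measurable_path[of "\<F> P" c t \<omega>] c t elim(2)
        by (simp add: \<C>_def set_borel_measurable_def)
      show "AE s in lborel. 0 \<le> indicator {0..t} s *\<^sub>R c s \<omega>"
        using c elim(2) by (intro AE_I2) (simp add: \<C>_def indicator_def)
      have "(\<integral>\<^sup>+ s. ennreal (indicator {0..t} s *\<^sub>R c s \<omega>) \<partial>lborel) = (\<integral>\<^sup>+ s\<in>{0..t}. ennreal (c s \<omega>) \<partial>lborel)"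
        by (intro nn_integral_cong) (simp add: indicator_def)
      then show "(\<integral>\<^sup>+ s. ennreal (indicator {0..t} s *\<^sub>R c s \<omega>) \<partial>lborel) < \<infinity>"
        using elim(1) t by simp
    qed
    show ?case
    proof (intro allI impI)
      \<comment> \<open>Controls are described at positive times; enlarging the interval to
        [0, t + 1] includes \<open>t = 0\<close>.\<close>
      fix t :: real assume "0 \<le> t"
      then show "set_integrable lborel {0..t} (\<lambda>s. c s \<omega>)"
        by (intro set_integrable_subset[OF int[of "t + 1"]]) auto
    qed
  qed
qed

theorem corollary3p1:
  fixes P :: "(real \<Rightarrow> real) measure"
    and \<alpha> \<sigma> \<mu> :: real
    and c :: "real \<Rightarrow> (real \<Rightarrow> real) \<Rightarrow> real"
  assumes "wiener_measure P"
    and "0 < \<alpha>" and "\<alpha> < 1" and "\<sigma> > 0" and "\<mu> > 0"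
    and "c \<in> \<C> P"
  shows "solves_sde P \<alpha> \<sigma> \<mu> c (\<lambda>t \<omega>. 0)
       \<and> solves_sde P \<alpha> \<sigma> \<mu> c (X_tilde \<alpha> \<sigma> \<mu> c)
       \<and> (AE \<omega> in completion P. \<forall>t>0. X_tilde \<alpha> \<sigma> \<mu> c t \<omega> > 0)
       \<and> \<not> indistinguishable (completion P) (\<lambda>t \<omega>. 0) (X_tilde \<alpha> \<sigma> \<mu> c)"
proof -
  interpret wiener_space P
    by standard fact
  let ?X = "X_tilde \<alpha> \<sigma> \<mu> c"
  have c: "progressively_measurable (\<F> P) c"
    using assms(6) by (simp add: \<C>_def)
  \<comment> \<open>For the zero solution \<open>z\<close> and \<open>Z\<close> vanish, and so does
    the drift because \<open>0 powr \<alpha> = 0\<close>.\<close>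
  have "is_primitive (\<lambda>_. 0) (\<lambda>_. 0)"
    by (simp add: is_primitive_def set_integrable_def)
  then have zero: "solves_sde P \<alpha> \<sigma> \<mu> c (\<lambda>t \<omega>. 0)"
    by (intro solves_sdeI assms(4) c progressively_measurable_time) (auto intro!: exI[of _ "\<lambda>_. 0"])
  have good: "AE \<omega> in completion P. \<omega> \<in> path_space \<and> (\<forall>t\<ge>0. set_integrable lborel {0..t} (\<lambda>s. c s \<omega>))"
    using AE_set_integrable_control[OF assms(6)] AE_space[of "completion P"] by eventually_elim simp
  have c_nonneg: "0 \<le> c t \<omega>" if "\<omega> \<in> path_space" "0 \<le> t" for t \<omega>
    using assms(6) that by (simp add: \<C>_def)
  have "solves_sde P \<alpha> \<sigma> \<mu> c ?X"
  proof (rule solves_sdeI[OF assms(4) c X_tilde_progressive[OF c]])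
    show "AE \<omega> in completion P. \<exists>z Z. is_primitive z Z \<and> (\<forall>t\<ge>0. ?X t \<omega> = exp_martingale \<sigma> t \<omega> * Z t \<and>
        exp_martingale \<sigma> t \<omega> * z t = ?X t \<omega> powr \<alpha> - \<mu> * ?X t \<omega> - c t \<omega> * ?X t \<omega>)"
      using good
    proof eventually_elim
      case (elim \<omega>)
      then show ?case
        by (intro X_tilde_path(1) assms W_continuous c_nonneg) blast+
    qed
  \<comment> \<open>Sign and initial value hold on every path: \<open>powr\<close> is nonnegative
    even where integrals take their default value.\<close>
  qed (simp_all add: X_tilde_def)
  moreover have pos: "AE \<omega> in completion P. \<forall>t>0. 0 < ?X t \<omega>"
    using good
  proof eventually_elim
    case (elim \<omega>)
    then show ?case
      by (intro allI impI X_tilde_path(2) assms W_continuous c_nonneg) blast+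
  qed
  moreover have "\<not> indistinguishable (completion P) (\<lambda>t \<omega>. 0) ?X"
  proof
    assume "indistinguishable (completion P) (\<lambda>t \<omega>. 0) ?X"
    then have "AE \<omega> in completion P. \<forall>t\<ge>0. 0 = ?X t \<omega>"
      unfolding indistinguishable_def .
    with pos have "AE \<omega> in completion P. False"
    proof eventually_elim
      case (elim \<omega>)
      \<comment> \<open>Time 1 stands for any positive time.\<close>
      from elim(1)[rule_format, of 1] elim(2)[rule_format, of 1] show False by simp
    qed
    then show False by simp
  qed
  ultimately show ?thesis using zero by blast
qed

end
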